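(* Let $\mathcal{A}$ be a central hyperplane arrangement in $\mathbb{C}^\ell$. Suppose that, for every subarrangement $\mathcal{B}\subseteq\mathcal{A}$, all essential components of $\mathcal{R}_1(\mathcal{B},\mathbb{C})$ arise from nets on $\mathcal{B}$. Then $$\mathcal{F}_{\mathrm{reg}}(A(\mathcal{A})\otimes\mathbb{C},\mathfrak{sl}_2(\mathbb{C}))=\bigcup_{\mathcal{B},\tau}\mathrm{ev}^{\mathcal{B}}_\tau\big(\mathcal{H}^K_{\mathrm{reg}}(\mathfrak{sl}_2(\mathbb{C}))\big),$$ where the union is taken over all $\mathcal{B}\subseteq\mathcal{A}$ and all non-constant special $K$-cocycles $\tau\in Z'_K(\mathcal{B})\setminus B_K(\mathcal{B})$ ($K$ ranging over finite sets with at least $3$ elements).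
   Context: An arrangement (a finite set of linear hyperplanes in $\mathbb{C}^\ell$) is viewed as a simple matroid via linear dependence of defining forms; $L_2(\mathcal{A})$ is the set of codimension-$2$ flats, a flat $X$ being identified with the set $\mathcal{A}_X$ of hyperplanes of $\mathcal{A}$ containing it. The Orlik–Solomon algebra is $A(\mathcal{A})=E/(\partial e_S : S\text{ a circuit})$, with $E$ the exterior algebra over $\mathbb{Z}$ on degree-one generators $e_H$, $H\in\mathcal{A}$, $\partial$ the graded derivation of degree $-1$ with $\partial e_H=1$, $e_S=\prod_{H\in S}e_H$. Resonance: $\mathcal{R}_1(\mathcal{B},\mathbb{C})\subseteq\mathbb{C}^{\mathcal{B}}=A^1(\mathcal{B})\otimes\mathbb{C}$ is the set of $a$ for which $(A(\mathcal{B})\otimes\mathbb{C},\,b\mapsto ab)$ has non-zero cohomology in degree $1$. Its irreducible components are linear subspaces; a component is essential if it is not contained in any coordinate hyperplane of $\mathbb{C}^{\mathcal{B}}$. A $k$-multinet on $\mathcal{B}$ ($k\ge 3$) is a partition into $k$ non-empty classes $\mathcal{B}_\alpha$, with positive integer multiplicities $m_H$ and a base locus $\mathcal{X}\subseteq L_2(\mathcal{B})$ of flats of multiplicity $|\mathcal{B}_X|>2$, such that: (1) $\sum_{H\in\mathcal{B}_\alpha}m_H$ is independent of $\alpha$; (2) if $H,H'$ are in different classes, then $H\cap H'\in\mathcal{X}$; (3) for $X\in\mathcal{X}$, $n_X:=\sum_{H\in\mathcal{B}_\alpha\cap\mathcal{B}_X}m_H$ is independent of $\alpha$; (4) for $H,H'\in\mathcal{B}_\alpha$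 there is a sequence $H=H_0,\dots,H_r=H'$ with $H_{i-1}\cap H_i\notin\mathcal{X}$ for all $i$. A $k$-net is a $k$-multinet with $n_X=1$ for all $X\in\mathcal{X}$. The component of $\mathcal{R}_1(\mathcal{B},\mathbb{C})$ arising from a $k$-net with classes $\mathcal{B}_1,\dots,\mathcal{B}_k$ is the span of $u_2-u_1,\dots,u_k-u_1$, where $u_\alpha=\sum_{H\in\mathcal{B}_\alpha}e_H$; it is an essential component. Special cocycles: for a finite set $K$ with at least $3$ elements, $B_K(\mathcal{B})\subseteq K^{\mathcal{B}}$ is the set of constant functions and $Z'_K(\mathcal{B})$ the set of functions $\tau\colon\mathcal{B}\to K$ whose restriction to each $X\in L_2(\mathcal{B})$ is either constant or bijective. Flat connections: for a finite-dimensional complex Lie algebra $\mathfrak{g}$ and $A=A(\mathcal{A})\otimes\mathbb{C}$ (with zero differential), $A\otimes\mathfrak{g}$ has bracket $[a\otimes x,b\otimes y]=ab\otimes[x,y]$, and $\mathcal{F}(A,\mathfrak{g})=\{\omega\in A^1\otimes\mathfrak{g}\mid[\omega,\omega]=0\}$. Writing $\omega=\sum_H e_H\otimes\omega_H$, $\omega$ is regular if $\dim\mathrm{span}\{\omega_H\}_{H\in\mathcal{A}}\ge 2$, and $\mathcal{F}_{\mathrm{reg}}(A,\mathfrak{g})$ is the set of regular elements. Evaluation: $\mathcal{H}^K(\mathfrak{g})=\{x=(x_\alpha)\in\mathfrak{g}^K\mid\sum_{\alpha\in K}x_\alpha=0\}$, and $\mathcal{H}^K_{\mathrm{reg}}(\mathfrak{g})$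 is the subset of those $x$ with $\dim\mathrm{span}\{x_\alpha\}_{\alpha\in K}\ge 2$. For $\mathcal{B}\subseteq\mathcal{A}$ and $\tau\in Z'_K(\mathcal{B})\setminus B_K(\mathcal{B})$, $\mathrm{ev}^{\mathcal{B}}_\tau\colon\mathcal{H}^K(\mathfrak{g})\to\mathcal{F}(A(\mathcal{A})\otimes\mathbb{C},\mathfrak{g})$ is the map $x\mapsto\sum_{H\in\mathcal{B}}e_H\otimes x_{\tau(H)}$ (it does take values in flat connections). *)

theory Defs
  imports "HOL-Analysis.Analysis" "HOL-Library.Poly_Mapping"
    "HOL-Computational_Algebra.Group_Closure"
begin

section \<open>Arrangements, flats and the underlying matroid\<close>

definition defining_form :: "complex^'l \<Rightarrow> (complex^'l) set \<Rightarrow> bool" where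
  "defining_form f H \<longleftrightarrow> f \<noteq> 0 \<and> H = {x. (\<Sum>i\<in>UNIV. f $ i * x $ i) = 0}"

definition arrangement :: "(complex^'l) set set \<Rightarrow> bool" where
  "arrangement B \<longleftrightarrow> finite B \<and> (\<forall>H\<in>B. \<exists>f. defining_form f H)"

text \<open>Distinct hyperplanes have non-proportional, hence distinct, defining forms, so nothing is
  lost by passing to the set of forms; the choice of the forms is immaterial.\<close>

definition hyp_dependent :: "(complex^'l) set set \<Rightarrow> bool" where
  "hyp_dependent S \<longleftrightarrow> (\<exists>\<phi>. (\<forall>H\<in>S. defining_form (\<phi> H) H) \<and> vec.dependent (\<phi> ` S))"

definition circuit :: "(complex^'l) set set \<Rightarrow> bool" where
  "circuit S \<longleftrightarrow> hyp_dependent S \<and> (\<forall>S'. S' \<subset> S \<longrightarrow> \<not> hyp_dependent S')"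

definition flats :: "(complex^'l) set set \<Rightarrow> (complex^'l) set set" where
  "flats B = {\<Inter>S | S. S \<subseteq> B}"

text \<open>\<^const>\<open>vec.dim\<close> is the dimension over the complex numbers, unlike \<^const>\<open>dim\<close>.\<close>

definition L2 :: "(complex^'l) set set \<Rightarrow> (complex^'l) set set" where
  "L2 B = {X \<in> flats B. vec.dim X + 2 = CARD('l)}"

definition localization :: "(complex^'l) set set \<Rightarrow> (complex^'l) set \<Rightarrow> (complex^'l) set set" where
  "localization B X = {H \<in> B. X \<subseteq> H}"


section \<open>The Orlik-Solomon algebra\<close>

text \<open>The free associative algebra over a ring \<open>'r\<close> on generators \<open>'h\<close> is the monoid algebra
  \<open>'h word \<Rightarrow>\<^sub>0 'r\<close> of the free monoid \<open>'h word\<close>, written additively because the product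
  of \<open>\<Rightarrow>\<^sub>0\<close> is the convolution along the additive structure of its domain.\<close>

datatype 'h word = Word (letters: "'h list")

instantiation word :: (type) monoid_add
begin

definition zero_word :: "'a word" where
  "zero_word = Word []"

definition plus_word :: "'a word \<Rightarrow> 'a word \<Rightarrow> 'a word" where
  "u + v = Word (letters u @ letters v)"

instance
  by standard (simp_all add: zero_word_def plus_word_def)

end

definition tens_alg :: "'h set \<Rightarrow> ('h word \<Rightarrow>\<^sub>0 'r::zero) set" where
  "tens_alg B = {p. \<forall>w \<in> Poly_Mapping.keys p. set (letters w) \<subseteq> B}"

definition tens_deg :: "nat \<Rightarrow> 'h set \<Rightarrow> ('h word \<Rightarrow>\<^sub>0 'r::zero) set" where
  "tens_deg q B = {p \<in> tens_alg B. \<forall>w \<in> Poly_Mapping.keys p. length (letters w) = q}"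

text \<open>The graded derivation on a product of generators, by the rule
  \<open>\<partial>(e\<^sub>H u) = (\<partial> e\<^sub>H) u - e\<^sub>H (\<partial> u)\<close> with \<open>\<partial> e\<^sub>H = 1\<close>.\<close>

fun bdry :: "'h list \<Rightarrow> ('h word \<Rightarrow>\<^sub>0 int)" where
  "bdry [] = 0"
| "bdry (h # hs) = Poly_Mapping.single (Word hs) 1 - Poly_Mapping.single (Word [h]) 1 * bdry hs"

text \<open>The first set consists of the relations of the exterior algebra, the second one of the
  \<open>\<partial> e\<^sub>S\<close> for the circuits \<open>S\<close>, with the factors of \<open>e\<^sub>S\<close> taken in every possible order (in the
  exterior algebra the order affects only the sign).\<close>

definition os_relations :: "(complex^'l) set set \<Rightarrow> ((complex^'l) set word \<Rightarrow>\<^sub>0 int) set" where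
  "os_relations B = {v * v | v. v \<in> tens_deg 1 B} \<union>
     {bdry hs | hs. distinct hs \<and> set hs \<subseteq> B \<and> circuit (set hs)}"

text \<open>The integral algebra \<open>A(B)\<close> is \<^term>\<open>tens_alg B\<close> modulo this two-sided ideal. Quotient
  types cannot depend on \<open>B\<close>, so we compute with representatives modulo ideals.\<close>

definition os_ideal :: "(complex^'l) set set \<Rightarrow> ((complex^'l) set word \<Rightarrow>\<^sub>0 int) set" where
  "os_ideal B = group_closure
     {u * r * v | u r v. u \<in> tens_alg B \<and> v \<in> tens_alg B \<and> r \<in> os_relations B}"

text \<open>For a bilinear \<open>act\<close> identifying \<open>R \<otimes> M\<close> with \<open>M\<close>, \<^term>\<open>pure_tensor act p x\<close> is
  \<open>p \<otimes> x\<close> as an element of the free algebra with coefficients in \<open>M\<close>, and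
  \<open>ideal_tensor act I M\<close> is the image of \<open>I \<otimes> M\<close>. By right exactness of the tensor product,
  \<open>(T / I) \<otimes> M\<close> is \<open>(T \<otimes> M)\<close> modulo \<open>ideal_tensor act I M\<close>.\<close>

definition pure_tensor ::
  "('r \<Rightarrow> 'm \<Rightarrow> 'm) \<Rightarrow> ('h word \<Rightarrow>\<^sub>0 'r::zero) \<Rightarrow> 'm::zero \<Rightarrow> ('h word \<Rightarrow>\<^sub>0 'm)" where
  "pure_tensor act p x = Poly_Mapping.map (\<lambda>c. act c x) p"

definition ideal_tensor ::
  "('r \<Rightarrow> 'm \<Rightarrow> 'm) \<Rightarrow> ('h word \<Rightarrow>\<^sub>0 'r::zero) set \<Rightarrow> 'm::ab_group_add set \<Rightarrow> ('h word \<Rightarrow>\<^sub>0 'm) set" where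
  "ideal_tensor act I M = group_closure {pure_tensor act p x | p x. p \<in> I \<and> x \<in> M}"

text \<open>The ideal presenting \<open>A(B) \<otimes> \<complex>\<close>.\<close>

definition os_ideal_C :: "(complex^'l) set set \<Rightarrow> ((complex^'l) set word \<Rightarrow>\<^sub>0 complex) set" where
  "os_ideal_C B = ideal_tensor (\<lambda>z c. of_int z * c) (os_ideal B) UNIV"


section \<open>Resonance\<close>

definition coord_space :: "'h set \<Rightarrow> ('h \<Rightarrow> complex) set" where
  "coord_space B = {a. \<forall>H. H \<notin> B \<longrightarrow> a H = 0}"

definition deg_one :: "'h set \<Rightarrow> ('h \<Rightarrow> 'm) \<Rightarrow> ('h word \<Rightarrow>\<^sub>0 'm::comm_monoid_add)" where
  "deg_one B a = (\<Sum>H\<in>B. Poly_Mapping.single (Word [H]) (a H))"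

definition resonance :: "(complex^'l) set set \<Rightarrow> ((complex^'l) set \<Rightarrow> complex) set" where
  "resonance B = {a \<in> coord_space B. \<exists>b \<in> tens_deg 1 B.
     deg_one B a * b \<in> os_ideal_C B \<and>
     \<not> (\<exists>c \<in> tens_deg 0 B. b - deg_one B a * c \<in> os_ideal_C B)}"

inductive_set poly_funs :: "'h set \<Rightarrow> (('h \<Rightarrow> complex) \<Rightarrow> complex) set" for B where
  const: "(\<lambda>a. c) \<in> poly_funs B"
| coord: "H \<in> B \<Longrightarrow> (\<lambda>a. a H) \<in> poly_funs B"
| add: "p \<in> poly_funs B \<Longrightarrow> q \<in> poly_funs B \<Longrightarrow> (\<lambda>a. p a + q a) \<in> poly_funs B"
| mult: "p \<in> poly_funs B \<Longrightarrow> q \<in> poly_funs B \<Longrightarrow> (\<lambda>a. p a * q a) \<in> poly_funs B"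

definition zariski_closed :: "'h set \<Rightarrow> ('h \<Rightarrow> complex) set \<Rightarrow> bool" where
  "zariski_closed B Z \<longleftrightarrow> (\<exists>P \<subseteq> poly_funs B. Z = {a \<in> coord_space B. \<forall>p\<in>P. p a = 0})"

definition zariski_irreducible :: "'h set \<Rightarrow> ('h \<Rightarrow> complex) set \<Rightarrow> bool" where
  "zariski_irreducible B V \<longleftrightarrow> V \<noteq> {} \<and> V \<subseteq> coord_space B \<and>
     (\<forall>Y Z. zariski_closed B Y \<and> zariski_closed B Z \<and> V \<subseteq> Y \<union> Z \<longrightarrow> V \<subseteq> Y \<or> V \<subseteq> Z)"

definition irreducible_component ::
  "'h set \<Rightarrow> ('h \<Rightarrow> complex) set \<Rightarrow> ('h \<Rightarrow> complex) set \<Rightarrow> bool" where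
  "irreducible_component B R V \<longleftrightarrow> V \<subseteq> R \<and> zariski_irreducible B V \<and>
     (\<forall>W. V \<subseteq> W \<and> W \<subseteq> R \<and> zariski_irreducible B W \<longrightarrow> W = V)"

definition essential :: "'h set \<Rightarrow> ('h \<Rightarrow> complex) set \<Rightarrow> bool" where
  "essential B V \<longleftrightarrow> (\<forall>H\<in>B. \<not> V \<subseteq> {a. a H = 0})"


section \<open>Multinets and nets\<close>

text \<open>The classes are indexed by \<open>{..<k}\<close>. Condition (4) asks for the sequence inside \<open>B\<close>; by
  condition (2) it then stays inside the class of \<open>H\<close>.\<close>

definition multinet :: "(complex^'l) set set \<Rightarrow> nat \<Rightarrow> (nat \<Rightarrow> (complex^'l) set set) \<Rightarrow>
    ((complex^'l) set \<Rightarrow> nat) \<Rightarrow> (complex^'l) set set \<Rightarrow> bool" where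
  "multinet B k cls m \<X> \<longleftrightarrow>
     k \<ge> 3 \<and>
     (\<forall>\<alpha><k. cls \<alpha> \<noteq> {}) \<and> (\<Union>\<alpha><k. cls \<alpha>) = B \<and>
     (\<forall>\<alpha><k. \<forall>\<beta><k. \<alpha> \<noteq> \<beta> \<longrightarrow> cls \<alpha> \<inter> cls \<beta> = {}) \<and>
     (\<forall>H\<in>B. m H > 0) \<and>
     \<X> \<subseteq> L2 B \<and> (\<forall>X\<in>\<X>. card (localization B X) > 2) \<and>
     (\<forall>\<alpha><k. \<forall>\<beta><k. (\<Sum>H\<in>cls \<alpha>. m H) = (\<Sum>H\<in>cls \<beta>. m H)) \<and>
     (\<forall>\<alpha><k. \<forall>\<beta><k. \<alpha> \<noteq> \<beta> \<longrightarrow> (\<forall>H\<in>cls \<alpha>. \<forall>H'\<in>cls \<beta>. H \<inter> H' \<in> \<X>)) \<and>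
     (\<forall>X\<in>\<X>. \<forall>\<alpha><k. \<forall>\<beta><k. (\<Sum>H \<in> cls \<alpha> \<inter> localization B X. m H)
                            = (\<Sum>H \<in> cls \<beta> \<inter> localization B X. m H)) \<and>
     (\<forall>\<alpha><k. \<forall>H\<in>cls \<alpha>. \<forall>H'\<in>cls \<alpha>. \<exists>(s :: nat \<Rightarrow> (complex^'l) set) r.
        s 0 = H \<and> s r = H' \<and> (\<forall>i\<le>r. s i \<in> B) \<and> (\<forall>i<r. s i \<inter> s (Suc i) \<notin> \<X>))"

definition net :: "(complex^'l) set set \<Rightarrow> nat \<Rightarrow> (nat \<Rightarrow> (complex^'l) set set) \<Rightarrow>
    ((complex^'l) set \<Rightarrow> nat) \<Rightarrow> (complex^'l) set set \<Rightarrow> bool" where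
  "net B k cls m \<X> \<longleftrightarrow> multinet B k cls m \<X> \<and>
     (\<forall>X\<in>\<X>. \<forall>\<alpha><k. (\<Sum>H \<in> cls \<alpha> \<inter> localization B X. m H) = 1)"

definition class_vec :: "'h set \<Rightarrow> 'h \<Rightarrow> complex" where
  "class_vec S H = (if H \<in> S then 1 else 0)"

text \<open>The span of the vectors \<open>u\<^sub>\<alpha> - u\<^sub>0\<close>, \<open>0 < \<alpha> < k\<close>.\<close>

definition net_component :: "nat \<Rightarrow> (nat \<Rightarrow> 'h set) \<Rightarrow> ('h \<Rightarrow> complex) set" where
  "net_component k cls =
     {\<lambda>H. \<Sum>\<alpha>\<in>{1..<k}. c \<alpha> * (class_vec (cls \<alpha>) H - class_vec (cls 0) H) | c. True}"

definition arises_from_net ::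
  "(complex^'l) set set \<Rightarrow> ((complex^'l) set \<Rightarrow> complex) set \<Rightarrow> bool" where
  "arises_from_net B V \<longleftrightarrow> (\<exists>k cls m \<X>. net B k cls m \<X> \<and> V = net_component k cls)"


section \<open>Special cocycles\<close>

definition const_cocycles :: "'k set \<Rightarrow> 'h set \<Rightarrow> ('h \<Rightarrow> 'k) set" where
  "const_cocycles K B = {\<tau> \<in> B \<rightarrow>\<^sub>E K. \<exists>\<kappa>\<in>K. \<forall>H\<in>B. \<tau> H = \<kappa>}"

definition special_cocycles :: "'k set \<Rightarrow> (complex^'l) set set \<Rightarrow> ((complex^'l) set \<Rightarrow> 'k) set" where
  "special_cocycles K B = {\<tau> \<in> B \<rightarrow>\<^sub>E K. \<forall>X \<in> L2 B.
     (\<exists>\<kappa>\<in>K. \<forall>H \<in> localization B X. \<tau> H = \<kappa>) \<or> bij_betw \<tau> (localization B X) K}"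


section \<open>Flat connections\<close>

text \<open>Lie algebras are taken to be complex Lie subalgebras of some \<open>gl\<^sub>n(\<complex>)\<close>. The library's
  scaling \<open>*s\<close> does not apply to matrices over the complex numbers, and \<open>*\<^sub>R\<close> is real.\<close>

definition mscale :: "complex \<Rightarrow> complex^'n^'n \<Rightarrow> complex^'n^'n" where
  "mscale c x = (\<chi> i j. c * x $ i $ j)"

interpretation mat: vector_space mscale
  by unfold_locales (simp_all add: mscale_def vec_eq_iff algebra_simps)

definition lie :: "complex^'n^'n \<Rightarrow> complex^'n^'n \<Rightarrow> complex^'n^'n" where
  "lie x y = x ** y - y ** x"

definition sl2 :: "(complex^2^2) set" where
  "sl2 = {x. trace x = 0}"

text \<open>The bilinear extension of \<open>[a \<otimes> x, b \<otimes> y] = ab \<otimes> [x, y]\<close>, on representatives.\<close>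

definition tens_lie ::
  "('h word \<Rightarrow>\<^sub>0 complex^'n^'n) \<Rightarrow> ('h word \<Rightarrow>\<^sub>0 complex^'n^'n) \<Rightarrow> ('h word \<Rightarrow>\<^sub>0 complex^'n^'n)" where
  "tens_lie \<Phi> \<Psi> = (\<Sum>u \<in> Poly_Mapping.keys \<Phi>. \<Sum>v \<in> Poly_Mapping.keys \<Psi>.
     Poly_Mapping.single (u + v) (lie (Poly_Mapping.lookup \<Phi> u) (Poly_Mapping.lookup \<Psi> v)))"

text \<open>An element \<open>\<Sum>\<^sub>H e\<^sub>H \<otimes> \<omega>\<^sub>H\<close> of \<open>A\<^sup>1 \<otimes> \<gg>\<close> is given by the family \<open>\<omega>\<close>, extended by zero.\<close>

definition flat_conn ::
  "(complex^'l) set set \<Rightarrow> (complex^'n^'n) set \<Rightarrow> ((complex^'l) set \<Rightarrow> complex^'n^'n) set" where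
  "flat_conn B \<gg> = {\<omega>. (\<forall>H\<in>B. \<omega> H \<in> \<gg>) \<and> (\<forall>H. H \<notin> B \<longrightarrow> \<omega> H = 0) \<and>
     tens_lie (deg_one B \<omega>) (deg_one B \<omega>) \<in> ideal_tensor mscale (os_ideal_C B) \<gg>}"

text \<open>\<^const>\<open>mat.dim\<close> of a set is the complex dimension of its span.\<close>

definition flat_conn_reg ::
  "(complex^'l) set set \<Rightarrow> (complex^'n^'n) set \<Rightarrow> ((complex^'l) set \<Rightarrow> complex^'n^'n) set" where
  "flat_conn_reg B \<gg> = {\<omega> \<in> flat_conn B \<gg>. mat.dim (mat.span (\<omega> ` B)) \<ge> 2}"

definition eval_dom :: "'k set \<Rightarrow> (complex^'n^'n) set \<Rightarrow> ('k \<Rightarrow> complex^'n^'n) set" where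
  "eval_dom K \<gg> = {x \<in> K \<rightarrow>\<^sub>E \<gg>. (\<Sum>\<alpha>\<in>K. x \<alpha>) = 0}"

definition eval_dom_reg :: "'k set \<Rightarrow> (complex^'n^'n) set \<Rightarrow> ('k \<Rightarrow> complex^'n^'n) set" where
  "eval_dom_reg K \<gg> = {x \<in> eval_dom K \<gg>. mat.dim (mat.span (x ` K)) \<ge> 2}"

definition ev :: "'h set \<Rightarrow> ('h \<Rightarrow> 'k) \<Rightarrow> ('k \<Rightarrow> complex^'n^'n) \<Rightarrow> 'h \<Rightarrow> complex^'n^'n" where
  "ev B \<tau> x H = (if H \<in> B then x (\<tau> H) else 0)"

end

theory Submission
  imports Defs
begin

text \<open>An element \<open>\<omega> = \<Sum> e\<^sub>H \<otimes> \<omega>\<^sub>H\<close> is flat iff \<open>[\<omega>\<^sub>H, \<omega>\<^sub>X] = 0\<close> for all \<open>X \<in> L\<^sub>2\<close> and all \<open>H\<close>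
  through \<open>X\<close>, where \<open>\<omega>\<^sub>X\<close> is the sum of the \<open>\<omega>\<^sub>K\<close> over the hyperplanes \<open>K\<close> through \<open>X\<close>. Since
  commuting elements of \<open>sl\<^sub>2\<close> are proportional, either \<open>\<omega>\<^sub>X = 0\<close> or all \<open>\<omega>\<^sub>H\<close> with \<open>H\<close> through \<open>X\<close>
  are multiples of \<open>\<omega>\<^sub>X\<close>. Hence, for linear forms \<open>f\<close>, \<open>g\<close> on \<open>sl\<^sub>2\<close>, the product
  \<open>f(\<omega>) g(\<omega>)\<close> vanishes in the Orlik-Solomon algebra of the support \<open>B\<close> of \<open>\<omega>\<close>. If \<open>\<omega>\<close> is
  regular, the vectors \<open>f(\<omega>)\<close> therefore form a linear subspace of the resonance variety of \<open>B\<close>.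
  It lies in some component, which is essential because it contains a subspace that no coordinate
  hyperplane contains, so it comes from a net. Thus \<open>\<omega>\<close> is constant on the classes of the net and its
  values on the classes sum to zero, and the class function is a special cocycle.\<close>

section \<open>Circuits and flats of codimension two\<close>

definition form :: "complex^'l \<Rightarrow> complex^'l \<Rightarrow> complex" where
  "form f x = (\<Sum>i\<in>UNIV. f $ i * x $ i)"

lemma form_linear [simp]:
  "form (f + g) x = form f x + form g x" "form (c *s f) x = c * form f x"
  "form f (x + y) = form f x + form f y" "form f (c *s x) = c * form f x"
  "form f (x - y) = form f x - form f y" "form 0 x = 0" "form f 0 = 0"
  by (simp_all add: form_def algebra_simps sum.distrib sum_distrib_left sum_subtractf)

lemma form_axis [simp]: "form f (axis i 1) = f $ i"
  by (simp add: form_def axis_def if_distrib[of "\<lambda>x. _ * x"] cong: if_cong)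

lemma form_eqI: "(\<And>x. form f x = form g x) \<Longrightarrow> f = g"
  by (metis form_axis vec_eq_iff)

lemma defining_form_iff: "defining_form f H \<longleftrightarrow> f \<noteq> 0 \<and> H = {x. form f x = 0}"
  by (simp add: defining_form_def form_def)

lemma form_ne_zero: "defining_form f H \<Longrightarrow> f \<noteq> 0"
  by (simp add: defining_form_iff)

lemma mem_iff_form: "defining_form f H \<Longrightarrow> x \<in> H \<longleftrightarrow> form f x = 0"
  by (simp add: defining_form_iff)

abbreviation hyperplane :: "(complex^'l) set \<Rightarrow> bool" where
  "hyperplane H \<equiv> \<exists>f. defining_form f H"

lemma subspace_hyperplane: "hyperplane H \<Longrightarrow> vec.subspace H"
  by (auto simp: defining_form_iff vec.subspace_def)

text \<open>If \<open>form f z = 1\<close>, then every \<open>y - form f y *s z\<close> lies in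
  \<open>H\<close>, hence in \<open>H'\<close>. So \<open>g\<close> is the multiple of
  \<open>f\<close> by the scalar \<open>form g z\<close>, which is non-zero because \<open>g\<close>
  is.\<close>

lemma hyperplane_subset_eq:
  assumes "hyperplane H" "hyperplane H'" "H \<subseteq> H'"
  shows "H = H'"
proof -
  obtain f g where f: "f \<noteq> 0" "H = {x. form f x = 0}" and g: "g \<noteq> 0" "H' = {x. form g x = 0}"
    using assms by (auto simp: defining_form_iff)
  obtain z0 where z0: "form f z0 \<noteq> 0"
    using f(1) form_eqI[of f 0] by auto
  define z where "z = (1 / form f z0) *s z0"
  have z: "form f z = 1"
    using z0 by (simp add: z_def)
  have eq: "form g y = form f y * form g z" for y
  proof -
    have "y - form f y *s z \<in> H"
      by (simp add: f z)
    then have "y - form f y *s z \<in> H'"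
      using assms(3) by blast
    then show ?thesis
      by (simp add: g)
  qed
  have "form g z \<noteq> 0"
  proof
    assume "form g z = 0"
    then have "form g y = form 0 y" for y
      by (simp add: eq[of y])
    then show False
      using form_eqI g(1) by blast
  qed
  then have "form g y = 0 \<longleftrightarrow> form f y = 0" for y
    by (subst eq) simp
  then show ?thesis
    by (simp add: f g)
qed

text \<open>Neither hyperplane contains the other, so each has a point off the other; rescaling
  these points gives vectors dual to \<open>f\<close> and \<open>g\<close>. They serve as
  coordinates modulo \<open>H \<inter> H'\<close>.\<close>

lemma dual_pair_of_forms:
  assumes "defining_form f H" "defining_form g H'" "H \<noteq> H'"
  obtains x y where "form f x = 0" "form g x = 1" "form f y = 1" "form g y = 0"
proof -
  obtain x where x: "x \<in> H" "x \<notin> H'"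
    using hyperplane_subset_eq[of H H'] assms by blast
  obtain y where y: "y \<in> H'" "y \<notin> H"
    using hyperplane_subset_eq[of H' H] assms by blast
  have "form f x = 0" "form g x \<noteq> 0" "form f y \<noteq> 0" "form g y = 0"
    using x y assms(1,2) by (simp_all add: mem_iff_form)
  then show ?thesis
    by (intro that[of "(1 / form g x) *s x" "(1 / form f y) *s y"]) simp_all
qed

lemma independent_two_forms:
  assumes "defining_form f H" "defining_form g H'" "H \<noteq> H'"
  shows "vec.independent {f, g}"
proof -
  obtain x y where xy: "form f x = 0" "form g x = 1" "form f y = 1" "form g y = 0"
    using dual_pair_of_forms[OF assms] .
  have "f \<notin> vec.span {g}"
  proof
    assume "f \<in> vec.span {g}"
    then obtain k where "f = k *s g"
      by (auto simp: vec.span_singleton)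
    then have "form f y = k * form g y"
      by simp
    then show False
      using xy by simp
  qed
  moreover have "g \<noteq> 0"
    using assms(2) by (rule form_ne_zero)
  ultimately show ?thesis
    by (simp add: vec.independent_insert)
qed

text \<open>The dual vectors \<open>y\<close> and \<open>x\<close> are adjoined to
  \<open>H \<inter> H'\<close> one after the other. Each is outside the span reached so far, and
  together they fill the whole space, so the codimension is two.\<close>

lemma dim_inter_hyperplanes:
  fixes H H' :: "(complex^'l) set"
  assumes "hyperplane H" "hyperplane H'" "H \<noteq> H'"
  shows "vec.dim (H \<inter> H') + 2 = CARD('l)"
proof -
  obtain f g where fg: "defining_form f H" "defining_form g H'"
    using assms by auto
  obtain x y where xy: "form f x = 0" "form g x = 1" "form f y = 1" "form g y = 0"
    using dual_pair_of_forms[OF fg assms(3)] .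
  let ?D = "H \<inter> H'"
  have D: "?D = {v. form f v = 0 \<and> form g v = 0}"
    using fg by (auto simp: mem_iff_form)
  have sub: "vec.subspace ?D"
    using assms by (simp add: subspace_hyperplane vec.subspace_inter)
  have y: "y \<notin> vec.span ?D"
  proof
    assume "y \<in> vec.span ?D"
    then have "y \<in> ?D"
      using sub by (metis vec.span_eq_iff)
    then show False
      using xy by (simp add: D)
  qed
  have "vec.span (insert y ?D) \<subseteq> H'"
    by (rule vec.span_minimal) (use fg(2) xy assms(2) in \<open>auto simp: mem_iff_form subspace_hyperplane\<close>)
  then have x: "x \<notin> vec.span (insert y ?D)"
    using mem_iff_form[OF fg(2), of x] xy by auto
  have "v \<in> vec.span (insert x (insert y ?D))" for v
  proof -
    have "v - form f v *s y - form g v *s x \<in> ?D"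
      by (simp add: D xy)
    then have "(v - form f v *s y - form g v *s x) + form f v *s y + form g v *s x
        \<in> vec.span (insert x (insert y ?D))"
      by (intro vec.span_add vec.span_scale) (auto intro: vec.span_base)
    then show ?thesis by simp
  qed
  then have "vec.span (insert x (insert y ?D)) = UNIV"
    by blast
  then have "vec.dim (insert x (insert y ?D)) = CARD('l)"
    using vec.dim_span[of "insert x (insert y ?D)"] by (simp only: vec_dim_card)
  then show ?thesis
    using x y by (simp add: vec.dim_insert)
qed

section \<open>Flats of codimension two as intersections of two hyperplanes\<close>

lemma inter_mem_L2:
  fixes B :: "(complex^'l) set set"
  assumes "arrangement B" "H \<in> B" "H' \<in> B" "H \<noteq> H'"
  shows "H \<inter> H' \<in> L2 B"
proof -
  have "H \<inter> H' = \<Inter>{H, H'}" "{H, H'} \<subseteq> B"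
    using assms by auto
  then have "H \<inter> H' \<in> flats B"
    unfolding flats_def by blast
  moreover have "vec.dim (H \<inter> H') + 2 = CARD('l)"
    using assms by (intro dim_inter_hyperplanes) (auto simp: arrangement_def)
  ultimately show ?thesis
    by (simp add: L2_def)
qed

text \<open>\<open>X\<close> is a subspace of \<open>H \<inter> H'\<close> of the same dimension.
  Hence each pair of distinct hyperplanes belongs to exactly one flat, which is what allows sums
  over pairs to be split by flats.\<close>

lemma L2_eq_inter:
  assumes "arrangement B" "X \<in> L2 B" "H \<in> localization B X" "H' \<in> localization B X" "H \<noteq> H'"
  shows "X = H \<inter> H'"
proof -
  have hyp: "\<forall>H\<in>B. hyperplane H"
    using assms by (simp add: arrangement_def)
  have H: "H \<in> B" "H' \<in> B" "X \<subseteq> H \<inter> H'"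
    using assms by (auto simp: localization_def)
  obtain S where S: "X = \<Inter>S" "S \<subseteq> B"
    using assms by (auto simp: L2_def flats_def)
  have "vec.subspace X"
    unfolding S by (rule vec.subspace_Inter) (use S hyp subspace_hyperplane in blast)
  moreover have "vec.dim (H \<inter> H') = vec.dim X"
    using dim_inter_hyperplanes[of H H'] assms H hyp by (simp add: L2_def)
  moreover have "vec.subspace (H \<inter> H')"
    using H hyp by (intro vec.subspace_inter subspace_hyperplane) auto
  ultimately show ?thesis
    using H by (intro vec.subspace_dim_equal) auto
qed

section \<open>Circuits with three elements\<close>

lemma not_hyp_dependent_if_card_le_2:
  assumes "finite S" "card S \<le> 2"
  shows "\<not> hyp_dependent S"
proof
  assume "hyp_dependent S"
  then obtain \<phi> where \<phi>: "\<forall>H\<in>S. defining_form (\<phi> H) H" "vec.dependent (\<phi> ` S)"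
    by (auto simp: hyp_dependent_def)
  consider "card S = 0" | "card S = 1" | "card S = 2"
    using assms by linarith
  then show False
  proof cases
    case 1
    then show False using assms \<phi> by (simp add: vec.independent_empty)
  next
    case 2
    then obtain H where "S = {H}" by (auto simp: card_1_singleton_iff)
    then show False using \<phi> form_ne_zero by auto
  next
    case 3
    then obtain H H' where "S = {H, H'}" "H \<noteq> H'" by (auto simp: card_2_iff)
    then show False using \<phi> independent_two_forms[of "\<phi> H" H "\<phi> H'" H'] by simp
  qed
qed

text \<open>Subtracting the components of \<open>v\<close> along the dual pair lands in
  \<open>a \<inter> b\<close>, hence in \<open>c\<close>. This writes \<open>h\<close> as a
  combination of \<open>f\<close> and \<open>g\<close>. Minimality is automatic, as two distinct
  hyperplanes are independent.\<close>

lemma circuit_if_inter_subset: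
  assumes "hyperplane a" "hyperplane b" "hyperplane c" "distinct [a, b, c]" "a \<inter> b \<subseteq> c"
  shows "circuit {a, b, c}"
proof -
  obtain f g h where *: "defining_form f a" "defining_form g b" "defining_form h c"
    using assms by auto
  obtain x y where xy: "form f x = 0" "form g x = 1" "form f y = 1" "form g y = 0"
    using dual_pair_of_forms[OF *(1,2)] assms by auto
  have "form h v = form (form h y *s f + form h x *s g) v" for v
  proof -
    have "v - form f v *s y - form g v *s x \<in> a \<inter> b"
      using * by (simp add: defining_form_iff xy)
    then have "v - form f v *s y - form g v *s x \<in> c"
      using assms by blast
    then show ?thesis
      using * by (simp add: defining_form_iff algebra_simps)
  qed
  then have h: "h = form h y *s f + form h x *s g"
    by (rule form_eqI)
  have "form h y *s f + form h x *s g \<in> vec.span {f, g}"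
    by (intro vec.span_add vec.span_scale) (auto intro: vec.span_base)
  then have h_span: "h \<in> vec.span {f, g}"
    using h by simp
  have neq: "f \<noteq> g" "f \<noteq> h" "g \<noteq> h"
    using * assms by (auto simp: defining_form_iff)
  then have "{f, g, h} - {h} = {f, g}"
    by auto
  with h_span have "h \<in> vec.span ({f, g, h} - {h})"
    by simp
  then have "vec.dependent {f, g, h}"
    unfolding vec.dependent_def by blast
  moreover define \<phi> where "\<phi> = (\<lambda>H. if H = a then f else if H = b then g else h)"
  ultimately have "hyp_dependent {a, b, c}"
    using * assms unfolding hyp_dependent_def by (intro exI[of _ \<phi>]) auto
  moreover have "\<not> hyp_dependent S" if "S \<subset> {a, b, c}" for S
  proof (rule not_hyp_dependent_if_card_le_2)
    show "finite S" using that by (auto intro: finite_subset[of S "{a, b, c}"])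
    have "card S < card {a, b, c}" using that by (simp add: psubset_card_mono)
    then show "card S \<le> 2" using assms by simp
  qed
  ultimately show ?thesis
    by (simp add: circuit_def)
qed

text \<open>The forms of \<open>a\<close> and \<open>b\<close> are independent, so dependence of all
  three puts the form of \<open>c\<close> in their span, and it vanishes wherever both do.\<close>

lemma inter_subset_if_circuit:
  assumes "circuit {a, b, c}" "distinct [a, b, c]"
  shows "a \<inter> b \<subseteq> c"
proof -
  obtain \<phi> where \<phi>: "\<forall>H\<in>{a, b, c}. defining_form (\<phi> H) H" "vec.dependent (\<phi> ` {a, b, c})"
    using assms by (auto simp: circuit_def hyp_dependent_def)
  have "vec.independent {\<phi> a, \<phi> b}"
    using \<phi> assms independent_two_forms[of "\<phi> a" a "\<phi> b" b] by simp
  then have "\<phi> c \<in> vec.span {\<phi> a, \<phi> b}"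
    using \<phi>(2) vec.independent_insertI[of "\<phi> c" "{\<phi> a, \<phi> b}"] by (auto simp: insert_commute)
  then obtain k where "\<phi> c - k *s \<phi> a \<in> vec.span {\<phi> b}"
    by (auto simp: vec.span_insert)
  then obtain l where kl: "\<phi> c - k *s \<phi> a = l *s \<phi> b"
    by (auto simp: vec.span_singleton)
  have "form (\<phi> c) x = k * form (\<phi> a) x + l * form (\<phi> b) x" for x
  proof -
    have "\<phi> c = k *s \<phi> a + l *s \<phi> b"
      using kl by (metis add.commute diff_add_cancel)
    then show ?thesis by simp
  qed
  moreover have "x \<in> a \<longleftrightarrow> form (\<phi> a) x = 0" "x \<in> b \<longleftrightarrow> form (\<phi> b) x = 0"
    "x \<in> c \<longleftrightarrow> form (\<phi> c) x = 0" for x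
    using \<phi>(1) by (simp_all add: mem_iff_form)
  ultimately show ?thesis
    by (simp add: subset_iff)
qed

lemma three_le_card_circuit: "circuit S \<Longrightarrow> finite S \<Longrightarrow> 3 \<le> card S"
  using not_hyp_dependent_if_card_le_2[of S] unfolding circuit_def by linarith

section \<open>The Orlik-Solomon ideal in degree two\<close>

lemma lookup_deg_one:
  assumes "finite B"
  shows "Poly_Mapping.lookup (deg_one B a) (Word [H]) = (if H \<in> B then a H else 0)"
    "length (letters w) \<noteq> 1 \<Longrightarrow> Poly_Mapping.lookup (deg_one B a) w = 0"
proof -
  show "Poly_Mapping.lookup (deg_one B a) (Word [H]) = (if H \<in> B then a H else 0)"
    using assms by (simp add: deg_one_def lookup_sum lookup_single when_def)
  show "Poly_Mapping.lookup (deg_one B a) w = 0" if "length (letters w) \<noteq> 1"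
    using that by (auto simp: deg_one_def lookup_sum lookup_single when_def intro!: sum.neutral)
qed

lemma word_cases_length:
  obtains H where "w = Word [H]" | "length (letters w) \<noteq> 1"
  by (cases w) (metis One_nat_def length_0_conv length_Suc_conv word.sel)

lemma deg_one_mem_tens_deg: "finite B \<Longrightarrow> deg_one B a \<in> tens_deg 1 B"
  unfolding tens_deg_def tens_alg_def
proof (safe, goal_cases)
  case (1 w x)
  then show ?case
    by (cases w rule: word_cases_length)
      (auto simp: in_keys_iff lookup_deg_one split: if_splits)
next
  case (2 w)
  then show ?case
    by (metis in_keys_iff lookup_deg_one(2))
qed

lemma tens_deg_one_eq:
  assumes "finite B" "v \<in> tens_deg 1 B"
  shows "v = deg_one B (\<lambda>H. Poly_Mapping.lookup v (Word [H]))"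
proof (rule poly_mapping_eqI)
  fix w
  have v: "set (letters w) \<subseteq> B \<and> length (letters w) = 1" if "Poly_Mapping.lookup v w \<noteq> 0" for w
    using assms(2) that by (auto simp: tens_deg_def tens_alg_def in_keys_iff)
  show "Poly_Mapping.lookup v w
      = Poly_Mapping.lookup (deg_one B (\<lambda>H. Poly_Mapping.lookup v (Word [H]))) w"
  proof (cases w rule: word_cases_length)
    case (1 H)
    then show ?thesis
      using v[of w] assms(1) by (auto simp: lookup_deg_one)
  next
    case 2
    then show ?thesis
      using v[of w] assms(1) by (auto simp: lookup_deg_one)
  qed
qed

text \<open>The coefficients are of arbitrary type because products of scalar one-forms and brackets
  of matrix-valued ones both have this shape.\<close>

definition quad :: "'h set \<Rightarrow> ('h \<Rightarrow> 'h \<Rightarrow> 'm) \<Rightarrow> ('h word \<Rightarrow>\<^sub>0 'm::comm_monoid_add)" where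
  "quad B c = (\<Sum>H\<in>B. \<Sum>H'\<in>B. Poly_Mapping.single (Word [H, H']) (c H H'))"

lemma lookup_quad:
  assumes "finite B"
  shows "Poly_Mapping.lookup (quad B c) (Word [H, H']) = (if H \<in> B \<and> H' \<in> B then c H H' else 0)"
    "length (letters w) \<noteq> 2 \<Longrightarrow> Poly_Mapping.lookup (quad B c) w = 0"
proof -
  have "Poly_Mapping.lookup (quad B c) (Word [H, H'])
      = (\<Sum>K\<in>B. \<Sum>K'\<in>B. if K' = H' then (if K = H then c K K' else 0) else 0)"
    by (auto simp: quad_def lookup_sum lookup_single when_def intro!: sum.cong)
  then show "Poly_Mapping.lookup (quad B c) (Word [H, H']) = (if H \<in> B \<and> H' \<in> B then c H H' else 0)"
    using assms by (cases "H' \<in> B") simp_all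
  show "Poly_Mapping.lookup (quad B c) w = 0" if "length (letters w) \<noteq> 2"
    using that by (auto simp: quad_def lookup_sum lookup_single when_def intro!: sum.neutral)
qed

lemma deg_one_mult: "deg_one B a * deg_one B b = quad B (\<lambda>H H'. a H * b H')"
  by (simp add: deg_one_def quad_def sum_product mult_single plus_word_def)

lemma lie_zero [simp]: "lie 0 x = 0" "lie x 0 = 0"
  by (simp_all add: lie_def)

lemma tens_lie_deg_one:
  assumes "finite B"
  shows "tens_lie (deg_one B \<omega>) (deg_one B \<omega>) = quad B (\<lambda>H H'. lie (\<omega> H) (\<omega> H'))"
proof -
  let ?d = "deg_one B \<omega>" and ?S = "(\<lambda>H. Word [H]) ` B"
  have keys: "Poly_Mapping.keys ?d \<subseteq> ?S"
  proof
    fix w assume "w \<in> Poly_Mapping.keys ?d"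
    then show "w \<in> ?S"
      by (cases w rule: word_cases_length)
        (auto simp: in_keys_iff lookup_deg_one assms split: if_splits)
  qed
  have inj: "inj_on (\<lambda>H. Word [H]) B"
    by (auto simp: inj_on_def)
  let ?t = "\<lambda>u v. Poly_Mapping.single (u + v) (lie (Poly_Mapping.lookup ?d u) (Poly_Mapping.lookup ?d v))"
  \<comment> \<open>The keys omit the hyperplanes with coefficient zero; enlarging both ranges to
    all of \<open>B\<close> only adds brackets with zero.\<close>
  have "tens_lie ?d ?d = (\<Sum>u\<in>Poly_Mapping.keys ?d. \<Sum>v\<in>?S. ?t u v)"
    unfolding tens_lie_def using keys assms
    by (intro sum.cong refl sum.mono_neutral_left) (auto simp: in_keys_iff)
  also have "\<dots> = (\<Sum>u\<in>?S. \<Sum>v\<in>?S. ?t u v)"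
    using keys assms by (intro sum.mono_neutral_left) (auto simp: in_keys_iff)
  also have "\<dots> = quad B (\<lambda>H H'. lie (\<omega> H) (\<omega> H'))"
    using assms by (simp add: sum.reindex[OF inj] quad_def lookup_deg_one plus_word_def)
  finally show ?thesis .
qed

text \<open>For \<open>L\<close> the set of hyperplanes through a flat of codimension two, and \<open>H \<in> L\<close>, this functional
  annihilates the relations; applied to \<open>[\<omega>, \<omega>]\<close> it gives \<open>2 [\<omega>\<^sub>H, \<omega>\<^sub>X]\<close>.\<close>

definition brk :: "'h set \<Rightarrow> 'h \<Rightarrow> ('h word \<Rightarrow>\<^sub>0 'm) \<Rightarrow> 'm::ab_group_add" where
  "brk L H p = (\<Sum>H'\<in>L. Poly_Mapping.lookup p (Word [H, H']) - Poly_Mapping.lookup p (Word [H', H]))"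

lemma brk_quad:
  assumes "finite B" "L \<subseteq> B" "H \<in> L"
  shows "brk L H (quad B c) = (\<Sum>H'\<in>L. c H H' - c H' H)"
  unfolding brk_def using assms by (intro sum.cong refl) (auto simp: lookup_quad)

text \<open>These conditions make sense for coefficients in any abelian group, so they can be
  carried from the integral ideal to the complex and the matrix-valued one. Vanishing below degree
  two makes the multipliers in \<open>u * r * v\<close> harmless.\<close>

definition os_null :: "(complex^'l) set set \<Rightarrow> ((complex^'l) set word \<Rightarrow>\<^sub>0 'm::ab_group_add) \<Rightarrow> bool" where
  "os_null B p \<longleftrightarrow> (\<forall>w. length (letters w) < 2 \<longrightarrow> Poly_Mapping.lookup p w = 0) \<and>
     (\<forall>X\<in>L2 B. \<forall>H\<in>localization B X. brk (localization B X) H p = 0)"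

lemma os_null_group_closure:
  assumes "p \<in> group_closure S" "\<And>s. s \<in> S \<Longrightarrow> os_null B s"
  shows "os_null B p"
  using assms(1)
proof induction
  case (base s)
  then show ?case
    using assms(2) by (auto simp: os_null_def brk_def)
next
  case (diff s t)
  then show ?case
    by (simp add: os_null_def brk_def lookup_minus algebra_simps sum.distrib sum_subtractf)
qed

lemma lookup_pure_tensor:
  "act 0 x = 0 \<Longrightarrow> Poly_Mapping.lookup (pure_tensor act p x) w = act (Poly_Mapping.lookup p w) x"
  by (simp add: pure_tensor_def map.rep_eq when_def)

text \<open>Tensoring applies an additive map to all coefficients, and \<open>brk\<close> commutes
  with additive maps.\<close>

lemma os_null_ideal_tensor:
  assumes "p \<in> ideal_tensor act I M" "\<And>q. q \<in> I \<Longrightarrow> os_null B q"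
    and act: "\<And>x. Modules.additive (\<lambda>c. act c x)"
  shows "os_null B p"
  using assms(1) unfolding ideal_tensor_def
proof (rule os_null_group_closure)
  fix s assume "s \<in> {pure_tensor act p x |p x. p \<in> I \<and> x \<in> M}"
  then obtain q x where q: "q \<in> I" "s = pure_tensor act q x"
    by auto
  interpret Modules.additive "\<lambda>c. act c x"
    by (rule act)
  have s: "Poly_Mapping.lookup s w = act (Poly_Mapping.lookup q w) x" for w
    by (simp add: q lookup_pure_tensor zero)
  have "brk L H s = act (brk L H q) x" for L H
    by (simp add: brk_def s sum diff)
  then show "os_null B s"
    using assms(2)[OF q(1)] by (simp add: os_null_def s zero)
qed

section \<open>Lowest-degree terms in the free algebra\<close>

definition order_ge :: "nat \<Rightarrow> ('h word \<Rightarrow>\<^sub>0 'r::zero) \<Rightarrow> bool" where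
  "order_ge d p \<longleftrightarrow> (\<forall>w. length (letters w) < d \<longrightarrow> Poly_Mapping.lookup p w = 0)"

lemma order_ge_mult:
  fixes p q :: "'h word \<Rightarrow>\<^sub>0 'r::semiring_0"
  assumes "order_ge d p" "order_ge e q"
  shows "order_ge (d + e) (p * q)"
  unfolding order_ge_def
proof (intro allI impI, rule ccontr)
  fix w :: "'h word" assume w: "length (letters w) < d + e" "Poly_Mapping.lookup (p * q) w \<noteq> 0"
  then obtain u v where "w = u + v" "u \<in> Poly_Mapping.keys p" "v \<in> Poly_Mapping.keys q"
    using keys_mult[of p q] by (auto simp: in_keys_iff)
  moreover from this have "\<not> length (letters u) < d" "\<not> length (letters v) < e"
    using assms by (auto simp: order_ge_def in_keys_iff)
  ultimately show False
    using w(1) by (simp add: plus_word_def)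
qed

lemma order_ge_one_diff: "order_ge 1 (u - Poly_Mapping.single 0 (Poly_Mapping.lookup u 0))"
  for u :: "'h word \<Rightarrow>\<^sub>0 int"
  unfolding order_ge_def
proof (intro allI impI)
  fix w :: "'h word" assume "length (letters w) < 1"
  then have "w = 0"
    by (cases w) (simp add: zero_word_def)
  then show "Poly_Mapping.lookup (u - Poly_Mapping.single 0 (Poly_Mapping.lookup u 0)) w = 0"
    by (simp add: lookup_minus)
qed

lemma lookup_single_zero_mult:
  fixes r :: "'h word \<Rightarrow>\<^sub>0 int"
  shows "Poly_Mapping.lookup (Poly_Mapping.single 0 c * r) w = c * Poly_Mapping.lookup r w"
    "Poly_Mapping.lookup (r * Poly_Mapping.single 0 c) w = Poly_Mapping.lookup r w * c"
proof -
  show 1: "Poly_Mapping.lookup (Poly_Mapping.single 0 c * r) w = c * Poly_Mapping.lookup r w"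
    by (simp add: mult_map_scale_conv_mult[symmetric] map.rep_eq when_def)
  \<comment> \<open>The free algebra is not commutative, but integers are central in every
    ring.\<close>
  have "Poly_Mapping.single 0 c = (of_int c :: 'h word \<Rightarrow>\<^sub>0 int)"
    using single_of_int[of c, where ?'b = int] by simp
  then have "r * Poly_Mapping.single 0 c = Poly_Mapping.single 0 c * r"
    by (simp add: mult_of_int_commute)
  then show "Poly_Mapping.lookup (r * Poly_Mapping.single 0 c) w = Poly_Mapping.lookup r w * c"
    using 1 by simp
qed

text \<open>Split off the constant terms of \<open>u\<close> and \<open>v\<close>. The remainders
  have order at least one, so their products with \<open>r\<close> start above degree
  \<open>d\<close> and only the constants contribute.\<close>

lemma lookup_mult_leading:
  fixes u r v :: "'h word \<Rightarrow>\<^sub>0 int"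
  assumes "order_ge d r" "length (letters w) \<le> d"
  shows "Poly_Mapping.lookup (u * r * v) w
    = Poly_Mapping.lookup u 0 * Poly_Mapping.lookup r w * Poly_Mapping.lookup v 0"
proof -
  define u' v' where "u' = u - Poly_Mapping.single 0 (Poly_Mapping.lookup u 0)"
    and "v' = v - Poly_Mapping.single 0 (Poly_Mapping.lookup v 0)"
  have u: "u = Poly_Mapping.single 0 (Poly_Mapping.lookup u 0) + u'"
    and v: "v = Poly_Mapping.single 0 (Poly_Mapping.lookup v 0) + v'"
    by (simp_all add: u'_def v'_def)
  have ord: "order_ge 1 u'" "order_ge 1 v'"
    unfolding u'_def v'_def by (rule order_ge_one_diff)+
  have "order_ge 0 u" by (simp add: order_ge_def)
  then have "order_ge (0 + d + 1) (u * r * v')"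
    by (intro order_ge_mult assms ord)
  then have 1: "Poly_Mapping.lookup (u * r * v') w = 0"
    using assms(2) by (simp add: order_ge_def)
  have "order_ge (1 + d) (u' * r)"
    by (intro order_ge_mult assms ord)
  then have 2: "Poly_Mapping.lookup (u' * r) w = 0"
    using assms(2) by (simp add: order_ge_def)
  have "Poly_Mapping.lookup (u * r * v) w = Poly_Mapping.lookup (u * r) w * Poly_Mapping.lookup v 0"
    by (subst v) (simp add: distrib_left lookup_add 1 lookup_single_zero_mult)
  also have "Poly_Mapping.lookup (u * r) w = Poly_Mapping.lookup u 0 * Poly_Mapping.lookup r w"
    by (subst u) (simp add: distrib_right lookup_add 2 lookup_single_zero_mult)
  finally show ?thesis .
qed

lemma length_of_keys_bdry: "w \<in> Poly_Mapping.keys (bdry hs) \<Longrightarrow> Suc (length (letters w)) = length hs"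
proof (induction hs arbitrary: w)
  case (Cons h hs)
  have "w \<in> Poly_Mapping.keys (Poly_Mapping.single (Word hs) (1::int)) \<or>
    w \<in> Poly_Mapping.keys (Poly_Mapping.single (Word [h]) 1 * bdry hs)"
    using Cons.prems keys_diff by fastforce
  then show ?case
  proof
    assume "w \<in> Poly_Mapping.keys (Poly_Mapping.single (Word [h]) 1 * bdry hs)"
    then obtain v where "w = Word [h] + v" "v \<in> Poly_Mapping.keys (bdry hs)"
      using keys_mult[of "Poly_Mapping.single (Word [h]) 1" "bdry hs"]
      by (auto split: if_splits)
    then show ?thesis
      using Cons.IH by (simp add: plus_word_def)
  qed simp
qed simp

lemma bdry_three: "bdry [a, b, c] = Poly_Mapping.single (Word [b, c]) 1
    - Poly_Mapping.single (Word [a, c]) 1 + Poly_Mapping.single (Word [a, b]) 1"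
proof -
  have "letters 0 = []"
    by (simp add: zero_word_def)
  then show ?thesis
    by (simp add: algebra_simps mult_single plus_word_def flip: single_one)
qed

text \<open>The three implications say that \<open>L\<close> contains all of \<open>a\<close>,
  \<open>b\<close>, \<open>c\<close> or at most one of them. In the first case the six terms cancel
  in pairs, in the second each of them is zero.\<close>

lemma brk_bdry_three:
  assumes "finite L" "H \<in> L" "distinct [a, b, c]"
    and "a \<in> L \<Longrightarrow> b \<in> L \<Longrightarrow> c \<in> L" "a \<in> L \<Longrightarrow> c \<in> L \<Longrightarrow> b \<in> L" "b \<in> L \<Longrightarrow> c \<in> L \<Longrightarrow> a \<in> L"
  shows "brk L H (bdry [a, b, c]) = 0"
proof -
  have "brk L H (bdry [a, b, c]) = (if b = H \<and> c \<in> L then 1 else 0) - (if a = H \<and> c \<in> L then 1 else 0)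
    + (if a = H \<and> b \<in> L then 1 else 0) - (if c = H \<and> b \<in> L then 1 else 0)
    + (if c = H \<and> a \<in> L then 1 else 0) - (if b = H \<and> a \<in> L then 1 else 0)"
    unfolding brk_def bdry_three using assms(1)
    by (cases "a = H"; cases "b = H"; cases "c = H")
      (simp_all add: lookup_add lookup_minus lookup_single when_def sum.distrib sum_subtractf)
  then show ?thesis
    using assms by auto
qed

text \<open>A square has symmetric coefficients, so its brackets cancel. The boundary of a circuit
  with more than three elements lives above degree two. For three elements, a localization that
  contains two of them contains the third.\<close>

lemma os_null_relation:
  assumes "arrangement B" "r \<in> os_relations B"
  shows "os_null B r"
proof -
  have fin: "finite B"
    using assms(1) by (simp add: arrangement_def)
  have loc: "localization B X \<subseteq> B" for X
    by (auto simp: localization_def)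
  from assms(2) consider (sq) v where "v \<in> tens_deg 1 B" "r = v * v"
    | (circuit) hs where "distinct hs" "set hs \<subseteq> B" "circuit (set hs)" "r = bdry hs"
    unfolding os_relations_def by auto
  then show ?thesis
  proof cases
    case sq
    define a where "a = (\<lambda>H. Poly_Mapping.lookup v (Word [H]))"
    have "r = quad B (\<lambda>H H'. a H * a H')"
      using tens_deg_one_eq[OF fin sq(1)] sq(2) by (simp add: a_def flip: deg_one_mult)
    then show ?thesis
      using fin loc by (simp add: os_null_def lookup_quad brk_quad)
  next
    case circuit
    have len: "3 \<le> length hs"
      using three_le_card_circuit[OF circuit(3)] circuit(1) by (simp add: distinct_card)
    have low: "Poly_Mapping.lookup r w = 0" if "Suc (length (letters w)) \<noteq> length hs" for w
      using length_of_keys_bdry[of w hs] that circuit(4) by (auto simp: in_keys_iff)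
    have "brk (localization B X) H r = 0" if X: "X \<in> L2 B" "H \<in> localization B X" for X H
    proof (cases "length hs = 3")
      case False
      then show ?thesis
        using len by (simp add: brk_def low)
    next
      case True
      then obtain a b c where hs: "hs = [a, b, c]"
        by (auto simp: numeral_3_eq_3 length_Suc_conv)
      \<comment> \<open>Any two of the three hyperplanes already cut out \<open>X\<close>, and by
        dependence the remaining one contains their intersection.\<close>
      have third: "z \<in> localization B X"
        if "{x, y, z} = set hs" "distinct [x, y, z]" "x \<in> localization B X" "y \<in> localization B X" for x y z
      proof -
        have "X = x \<inter> y"
          using L2_eq_inter[OF assms(1) X(1)] that by simp
        moreover have "x \<inter> y \<subseteq> z"
          using inter_subset_if_circuit[of x y z] that circuit by simp
        moreover have "z \<in> B"
          using circuit that by auto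
        ultimately show ?thesis
          by (simp add: localization_def)
      qed
      show ?thesis
        unfolding circuit(4) hs
      proof (rule brk_bdry_three)
        show "finite (localization B X)"
          using fin loc finite_subset by blast
      qed (use circuit(1) hs X third[of a b c] third[of a c b] third[of b c a] in auto)
    qed
    then show ?thesis
      using low len by (simp add: os_null_def)
  qed
qed

text \<open>Relations have order at least two, so in degrees up to two, the only ones that
  \<open>os_null\<close> inspects, \<open>u * r * v\<close> is an integer multiple of
  \<open>r\<close>.\<close>

lemma os_null_os_ideal:
  assumes "arrangement B" "p \<in> os_ideal B"
  shows "os_null B p"
  using assms(2) unfolding os_ideal_def
proof (rule os_null_group_closure)
  fix s assume "s \<in> {u * r * v |u r v. u \<in> tens_alg B \<and> v \<in> tens_alg B \<and> r \<in> os_relations B}"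
  then obtain u r v where s: "s = u * r * v" and r: "os_null B r"
    using os_null_relation[OF assms(1)] by auto
  define k where "k = Poly_Mapping.lookup u 0 * Poly_Mapping.lookup v 0"
  have "order_ge 2 r"
    using r by (simp add: order_ge_def os_null_def)
  then have "Poly_Mapping.lookup s w = k * Poly_Mapping.lookup r w" if "length (letters w) \<le> 2" for w
    using lookup_mult_leading[of 2 r w u v] that s by (simp add: k_def)
  moreover from this have "brk L H s = k * brk L H r" for L H
    by (simp add: brk_def sum_distrib_left right_diff_distrib)
  ultimately show "os_null B s"
    using r by (simp add: os_null_def)
qed

lemma os_null_os_ideal_C: "arrangement B \<Longrightarrow> p \<in> os_ideal_C B \<Longrightarrow> os_null B p"
  unfolding os_ideal_C_def
  by (rule os_null_ideal_tensor) (auto simp: os_null_os_ideal Modules.additive_def algebra_simps)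

lemma os_null_os_ideal_mat:
  "arrangement B \<Longrightarrow> p \<in> ideal_tensor mscale (os_ideal_C B) \<gg> \<Longrightarrow> os_null B p"
  by (rule os_null_ideal_tensor) (auto simp: os_null_os_ideal_C Modules.additive_def mat.scale_left_distrib)

section \<open>A sufficient condition for membership in the ideal in degree two\<close>

lemma sum_mem_if_diff_closed:
  fixes J :: "'m::ab_group_add set"
  assumes "0 \<in> J" "\<And>p q. p \<in> J \<Longrightarrow> q \<in> J \<Longrightarrow> p - q \<in> J" "\<And>i. i \<in> I \<Longrightarrow> f i \<in> J"
  shows "sum f I \<in> J"
proof -
  have add: "p + q \<in> J" if "p \<in> J" "q \<in> J" for p q
    using assms(2)[OF that(1) assms(2)[OF assms(1) that(2)]] by simp
  show ?thesis
    using assms(3) by (induction I rule: infinite_finite_induct) (auto intro: add assms(1))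
qed

lemma single_sum: "Poly_Mapping.single w (sum f S) = (\<Sum>i\<in>S. Poly_Mapping.single w (f i))"
  by (induction S rule: infinite_finite_induct) (simp_all add: single_add)

text \<open>Only additive closure and the degree-two relations with coefficients in \<open>M\<close>
  are recorded. This lets one argument serve both the complex ideal and the ideal with coefficients
  in a Lie algebra.\<close>

definition os_submodule ::
  "(complex^'l) set set \<Rightarrow> 'm set \<Rightarrow> ((complex^'l) set word \<Rightarrow>\<^sub>0 'm::ab_group_add) set \<Rightarrow> bool" where
  "os_submodule B M J \<longleftrightarrow> 0 \<in> J \<and> (\<forall>p\<in>J. \<forall>q\<in>J. p - q \<in> J) \<and>
     (\<forall>x\<in>M. \<forall>a\<in>B. Poly_Mapping.single (Word [a, a]) x \<in> J) \<and>
     (\<forall>x\<in>M. \<forall>a\<in>B. \<forall>b\<in>B. a \<noteq> b \<longrightarrow>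
        Poly_Mapping.single (Word [a, b]) x + Poly_Mapping.single (Word [b, a]) x \<in> J) \<and>
     (\<forall>x\<in>M. \<forall>a\<in>B. \<forall>b\<in>B. \<forall>c\<in>B. distinct [a, b, c] \<longrightarrow> circuit {a, b, c} \<longrightarrow>
        Poly_Mapping.single (Word [b, c]) x - Poly_Mapping.single (Word [a, c]) x
          + Poly_Mapping.single (Word [a, b]) x \<in> J)"

lemma os_submoduleD:
  assumes "os_submodule B M J"
  shows "0 \<in> J" "p \<in> J \<Longrightarrow> q \<in> J \<Longrightarrow> p - q \<in> J"
    "x \<in> M \<Longrightarrow> a \<in> B \<Longrightarrow> Poly_Mapping.single (Word [a, a]) x \<in> J"
    "x \<in> M \<Longrightarrow> a \<in> B \<Longrightarrow> b \<in> B \<Longrightarrow> a \<noteq> b \<Longrightarrow>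
      Poly_Mapping.single (Word [a, b]) x + Poly_Mapping.single (Word [b, a]) x \<in> J"
    "x \<in> M \<Longrightarrow> a \<in> B \<Longrightarrow> b \<in> B \<Longrightarrow> c \<in> B \<Longrightarrow> distinct [a, b, c] \<Longrightarrow> circuit {a, b, c} \<Longrightarrow>
      Poly_Mapping.single (Word [b, c]) x - Poly_Mapping.single (Word [a, c]) x
        + Poly_Mapping.single (Word [a, b]) x \<in> J"
  using assms by (simp_all add: os_submodule_def)

text \<open>Modulo \<open>J\<close>, \<open>e\<^sub>H e\<^sub>K = e\<^sub>h e\<^sub>K - e\<^sub>h e\<^sub>H\<close> for all \<open>H\<close>, \<open>K\<close>, \<open>h\<close> through \<open>X\<close>;
  with \<open>h\<close> fixed the right-hand sides cancel in the sum.\<close>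

lemma quad_localization_mem:
  assumes arr: "arrangement B" and J: "os_submodule B M J" and X: "X \<in> L2 B"
    and cM: "\<And>H H'. H \<in> B \<Longrightarrow> H' \<in> B \<Longrightarrow> c H H' \<in> M"
    and bal: "\<And>H. H \<in> localization B X \<Longrightarrow> (\<Sum>H'\<in>localization B X. c H H' - c H' H) = 0"
  shows "quad (localization B X) c \<in> J"
proof (cases "localization B X = {}")
  case True
  then show ?thesis
    using J by (simp add: quad_def os_submodule_def)
next
  case False
  let ?L = "localization B X" and ?s = "\<lambda>H H'. Poly_Mapping.single (Word [H, H'])"
  obtain h where h: "h \<in> ?L"
    using False by auto
  have LB: "?L \<subseteq> B"
    by (auto simp: localization_def)
  have J0: "0 \<in> J" and Jd: "\<And>p q. p \<in> J \<Longrightarrow> q \<in> J \<Longrightarrow> p - q \<in> J"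
    using J by (simp_all add: os_submodule_def)
  have rel: "?s H K x - ?s h K x + ?s h H x \<in> J"
    if H: "H \<in> ?L" and K: "K \<in> ?L" and x: "x \<in> M" for H K x
  proof -
    have B: "h \<in> B" "H \<in> B" "K \<in> B"
      using H K h LB by auto
    have sq: "?s h h x \<in> J" "?s H H x \<in> J"
      using os_submoduleD(3)[OF J x] B by auto
    \<comment> \<open>The degenerate cases follow from squares and anticommutators; only three
      distinct hyperplanes call for a circuit relation.\<close>
    consider "H = K" | "H = h" | "H \<noteq> h" "K = h" | "distinct [h, H, K]"
      by auto
    then show ?thesis
    proof cases
      case 3
      have "?s h H x + ?s H h x \<in> J"
        using os_submoduleD(4)[OF J x] B 3 by auto
      from Jd[OF this sq(1)] show ?thesis
        using 3 by (simp add: algebra_simps)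
    next
      case 4
      have "h \<inter> H \<subseteq> K"
        using L2_eq_inter[OF arr X h H] K 4 by (auto simp: localization_def)
      moreover have "hyperplane h" "hyperplane H" "hyperplane K"
        using arr B by (auto simp: arrangement_def)
      ultimately have "circuit {h, H, K}"
        using 4 by (intro circuit_if_inter_subset)
      then show ?thesis
        by (rule os_submoduleD(5)[OF J x B 4])
    qed (use sq in simp_all)
  qed
  \<comment> \<open>After exchanging the order of summation, the coefficient of
    \<open>Word [h, K]\<close> is minus the sum in \<open>bal\<close> for \<open>K\<close>.\<close>
  have "(\<Sum>H\<in>?L. \<Sum>K\<in>?L. ?s h K (c H K)) - (\<Sum>H\<in>?L. \<Sum>K\<in>?L. ?s h H (c H K))
      = (\<Sum>K\<in>?L. \<Sum>H\<in>?L. ?s h K (c H K)) - (\<Sum>K\<in>?L. \<Sum>H\<in>?L. ?s h K (c K H))"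
    by (subst sum.swap) simp
  also have "\<dots> = - (\<Sum>K\<in>?L. ?s h K (\<Sum>H\<in>?L. c K H - c H K))"
    by (simp add: single_diff sum_subtractf single_sum)
  also have "\<dots> = 0"
    by (simp add: bal)
  finally have "quad ?L c = (\<Sum>H\<in>?L. \<Sum>K\<in>?L. ?s H K (c H K) - ?s h K (c H K) + ?s h H (c H K))"
    by (simp add: quad_def sum.distrib sum_subtractf algebra_simps)
  also have "\<dots> \<in> J"
    using LB by (intro sum_mem_if_diff_closed J0 Jd rel cM) auto
  finally show ?thesis .
qed

text \<open>Off-diagonal pairs are grouped by their intersection, a flat in \<open>L2 B\<close>.
  Each group is the \<open>quad\<close> of a localization without its diagonal, and diagonal terms
  can be added or removed freely because squares lie in \<open>J\<close>.\<close>

lemma quad_mem: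
  fixes B :: "(complex^'l) set set"
  assumes arr: "arrangement B" and J: "os_submodule B M J"
    and cM: "\<And>H H'. H \<in> B \<Longrightarrow> H' \<in> B \<Longrightarrow> c H H' \<in> M"
    and bal: "\<And>X H. X \<in> L2 B \<Longrightarrow> H \<in> localization B X \<Longrightarrow>
      (\<Sum>H'\<in>localization B X. c H H' - c H' H) = 0"
  shows "quad B c \<in> J"
proof -
  have fin: "finite B"
    using arr by (simp add: arrangement_def)
  have J0: "0 \<in> J" and Jd: "\<And>p q. p \<in> J \<Longrightarrow> q \<in> J \<Longrightarrow> p - q \<in> J"
    and sq: "\<And>H. H \<in> B \<Longrightarrow> Poly_Mapping.single (Word [H, H]) (c H H) \<in> J"
    using J cM by (simp_all add: os_submodule_def)
  let ?t = "\<lambda>(H, H'). Poly_Mapping.single (Word [H, H']) (c H H')"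
  define off where "off L = {(H, H'). H \<in> L \<and> H' \<in> L \<and> H \<noteq> H'}" for L :: "(complex^'l) set set"
  have split: "quad L c = sum ?t (off L) + (\<Sum>H\<in>L. ?t (H, H))" if "L \<subseteq> B" for L
  proof -
    have "finite L"
      using that fin finite_subset by blast
    have "quad L c = sum ?t (L \<times> L)"
      by (simp add: quad_def sum.cartesian_product)
    also have "L \<times> L = off L \<union> (\<lambda>H. (H, H)) ` L"
      by (auto simp: off_def)
    also have "sum ?t \<dots> = sum ?t (off L) + sum ?t ((\<lambda>H. (H, H)) ` L)"
      using \<open>finite L\<close> finite_subset[of "off L" "L \<times> L"]
      by (intro sum.union_disjoint) (auto simp: off_def)
    also have "sum ?t ((\<lambda>H. (H, H)) ` L) = (\<Sum>H\<in>L. ?t (H, H))"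
      by (subst sum.reindex) (auto simp: inj_on_def)
    finally show ?thesis .
  qed
  have diag: "(\<Sum>H\<in>L. ?t (H, H)) \<in> J" if "L \<subseteq> B" for L
    using that sq by (intro sum_mem_if_diff_closed J0 Jd) auto
  have "sum ?t (off B) = (\<Sum>X\<in>L2 B \<inter> (\<lambda>(H, H'). H \<inter> H') ` off B.
      sum ?t {p \<in> off B. (\<lambda>(H, H'). H \<inter> H') p = X})"
  proof (rule sum.group[symmetric])
    show "finite (off B)"
      using fin finite_subset[of "off B" "B \<times> B"] by (auto simp: off_def)
    then show "finite (L2 B \<inter> (\<lambda>(H, H'). H \<inter> H') ` off B)"
      by simp
    show "(\<lambda>(H, H'). H \<inter> H') ` off B \<subseteq> L2 B \<inter> (\<lambda>(H, H'). H \<inter> H') ` off B"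
      using inter_mem_L2[OF arr] by (auto simp: off_def)
  qed
  also have "\<dots> \<in> J"
  proof (rule sum_mem_if_diff_closed[OF J0 Jd])
    fix X assume "X \<in> L2 B \<inter> (\<lambda>(H, H'). H \<inter> H') ` off B"
    then have X: "X \<in> L2 B"
      by simp
    have LB: "localization B X \<subseteq> B"
      by (auto simp: localization_def)
    have off_eq: "{p \<in> off B. (\<lambda>(H, H'). H \<inter> H') p = X} = off (localization B X)"
      using L2_eq_inter[OF arr X] by (auto simp: off_def localization_def)
    have "quad (localization B X) c \<in> J"
      by (rule quad_localization_mem[OF arr J X cM bal[OF X]])
    from Jd[OF this diag[OF LB]]
    show "sum ?t {p \<in> off B. (\<lambda>(H, H'). H \<inter> H') p = X} \<in> J"
      unfolding off_eq split[OF LB] by simp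
  qed
  finally have "sum ?t (off B) \<in> J" .
  moreover have "- (\<Sum>H\<in>B. ?t (H, H)) \<in> J"
    using Jd[OF J0 diag] by simp
  ultimately have "sum ?t (off B) - - (\<Sum>H\<in>B. ?t (H, H)) \<in> J"
    by (rule Jd)
  then show ?thesis
    using split[of B] by simp
qed

lemma pure_tensor_single: "act 0 x = 0 \<Longrightarrow>
    pure_tensor act (Poly_Mapping.single w r) x = Poly_Mapping.single w (act r x)"
  by (rule poly_mapping_eqI) (simp add: lookup_pure_tensor lookup_single when_def)

lemma pure_tensor_add_diff:
  assumes "Modules.additive (\<lambda>c. act c x)"
  shows "pure_tensor act (p + q) x = pure_tensor act p x + pure_tensor act q x"
    "pure_tensor act (p - q) x = pure_tensor act p x - pure_tensor act q x"
proof -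
  interpret Modules.additive "\<lambda>c. act c x"
    by (rule assms)
  show "pure_tensor act (p + q) x = pure_tensor act p x + pure_tensor act q x"
    "pure_tensor act (p - q) x = pure_tensor act p x - pure_tensor act q x"
    by (rule poly_mapping_eqI, simp add: lookup_pure_tensor zero lookup_add lookup_minus add diff)+
qed

text \<open>Since \<open>u\<close> acts as the identity, tensoring a relation with coefficient
  \<open>u\<close> by \<open>x\<close> gives the same relation with coefficient \<open>x\<close>.
  This is used twice, from the integers to \<complex> and from \<complex> to \<gg>.\<close>

lemma os_submodule_ideal_tensor:
  fixes act :: "'r::ab_group_add \<Rightarrow> 'm \<Rightarrow> 'm::ab_group_add"
  assumes I: "os_submodule B R I" and u: "u \<in> R" "\<And>x. act u x = x"
    and act: "\<And>x. Modules.additive (\<lambda>c. act c x)"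
  shows "os_submodule B M (ideal_tensor act I M)"
proof -
  have zero: "act 0 x = 0" for x
    using additive.zero[OF act] .
  have mem: "pure_tensor act p x \<in> ideal_tensor act I M" if "p \<in> I" "x \<in> M" for p x
    unfolding ideal_tensor_def using that by (intro group_closure.base) auto
  note tensor = pure_tensor_add_diff[OF act] pure_tensor_single[where act = act, OF zero] u(2)
  show ?thesis
    unfolding os_submodule_def
  proof (intro conjI ballI impI)
    show "0 \<in> ideal_tensor act I M"
      by (simp add: ideal_tensor_def)
    show "p - q \<in> ideal_tensor act I M" if "p \<in> ideal_tensor act I M" "q \<in> ideal_tensor act I M" for p q
      using that unfolding ideal_tensor_def by (rule group_closure.diff)
    fix x a assume x: "x \<in> M" and a: "a \<in> B"
    have "Poly_Mapping.single (Word [a, a]) u \<in> I"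
      by (rule os_submoduleD(3)[OF I u(1) a])
    from mem[OF this x] show "Poly_Mapping.single (Word [a, a]) x \<in> ideal_tensor act I M"
      by (simp add: tensor)
    fix b assume b: "b \<in> B"
    show "Poly_Mapping.single (Word [a, b]) x + Poly_Mapping.single (Word [b, a]) x \<in> ideal_tensor act I M"
      if "a \<noteq> b"
    proof -
      have "Poly_Mapping.single (Word [a, b]) u + Poly_Mapping.single (Word [b, a]) u \<in> I"
        by (rule os_submoduleD(4)[OF I u(1) a b that])
      from mem[OF this x] show ?thesis
        by (simp add: tensor)
    qed
    fix c assume c: "c \<in> B" and abc: "distinct [a, b, c]" "circuit {a, b, c}"
    have "Poly_Mapping.single (Word [b, c]) u - Poly_Mapping.single (Word [a, c]) u
        + Poly_Mapping.single (Word [a, b]) u \<in> I"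
      by (rule os_submoduleD(5)[OF I u(1) a b c abc])
    from mem[OF this x] show "Poly_Mapping.single (Word [b, c]) x - Poly_Mapping.single (Word [a, c]) x
        + Poly_Mapping.single (Word [a, b]) x \<in> ideal_tensor act I M"
      by (simp add: tensor)
  qed
qed

lemma os_submodule_os_ideal: "os_submodule B {1} (os_ideal B)"
proof -
  have one: "1 \<in> tens_alg B"
    by (auto simp: tens_alg_def zero_word_def)
  have rel: "r \<in> os_ideal B" if "r \<in> os_relations B" for r
  proof -
    have "r = 1 * r * 1"
      by simp
    then show ?thesis
      unfolding os_ideal_def using one that by (intro group_closure.base) blast
  qed
  have sq: "v * v \<in> os_ideal B" if "v \<in> tens_deg 1 B" for v
    using that by (intro rel) (auto simp: os_relations_def)
  let ?e = "\<lambda>H. Poly_Mapping.single (Word [H]) (1::int)"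
  have ee: "?e a * ?e b = Poly_Mapping.single (Word [a, b]) 1" for a b
    by (simp add: mult_single plus_word_def)
  have gen: "?e a \<in> tens_deg 1 B" if "a \<in> B" for a
    using that by (simp add: tens_deg_def tens_alg_def)
  have diff: "p - q \<in> os_ideal B" if "p \<in> os_ideal B" "q \<in> os_ideal B" for p q
    using that unfolding os_ideal_def by (rule group_closure.diff)
  show ?thesis
    unfolding os_submodule_def
  proof (intro conjI ballI impI)
    show "0 \<in> os_ideal B"
      by (simp add: os_ideal_def)
    fix x :: int and a assume x: "x \<in> {1}" and a: "a \<in> B"
    show "Poly_Mapping.single (Word [a, a]) x \<in> os_ideal B"
      using sq[OF gen[OF a]] x by (simp add: ee)
    fix b assume b: "b \<in> B"
    \<comment> \<open>Polarization: the square of the sum minus the two squares is the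
      anticommutator.\<close>
    have "?e a + ?e b \<in> tens_deg 1 B"
      using gen[OF a] gen[OF b] keys_add[of "?e a" "?e b"] by (auto simp: tens_deg_def tens_alg_def)
    from diff[OF diff[OF sq[OF this] sq[OF gen[OF a]]] sq[OF gen[OF b]]]
    show "Poly_Mapping.single (Word [a, b]) x + Poly_Mapping.single (Word [b, a]) x \<in> os_ideal B"
      using x by (simp add: distrib_left distrib_right ee add.commute)
    fix c assume c: "c \<in> B" and abc: "distinct [a, b, c]" "circuit {a, b, c}"
    have "bdry [a, b, c] \<in> os_relations B"
      using a b c abc by (auto simp: os_relations_def simp del: bdry.simps intro!: exI[of _ "[a, b, c]"])
    from rel[OF this]
    show "Poly_Mapping.single (Word [b, c]) x - Poly_Mapping.single (Word [a, c]) x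
        + Poly_Mapping.single (Word [a, b]) x \<in> os_ideal B"
      using x by (simp only: bdry_three singleton_iff)
  qed (rule diff)
qed

lemma os_submodule_os_ideal_C: "os_submodule B UNIV (os_ideal_C B)"
  unfolding os_ideal_C_def
  by (rule os_submodule_ideal_tensor[OF os_submodule_os_ideal, of 1])
    (auto simp: Modules.additive_def algebra_simps)

lemma os_submodule_os_ideal_mat: "os_submodule B \<gg> (ideal_tensor mscale (os_ideal_C B) \<gg>)"
  by (rule os_submodule_ideal_tensor[OF os_submodule_os_ideal_C, of 1])
    (auto simp: Modules.additive_def mat.scale_left_distrib)

section \<open>Flatness as a local condition\<close>

lemma lie_add_right: "lie x (y + z) = lie x y + lie x z"
  by (simp add: lie_def matrix_matrix_mult_def vec_eq_iff algebra_simps sum.distrib)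

lemma lie_sum_right: "lie x (sum f S) = (\<Sum>i\<in>S. lie x (f i))"
  by (induction S rule: infinite_finite_induct) (simp_all add: lie_add_right)

lemma lie_self [simp]: "lie x x = 0"
  by (simp add: lie_def)

lemma lie_mem_sl2: "lie x y \<in> sl2"
  using trace_mul_sym[of x y] by (simp add: lie_def sl2_def trace_sub)

text \<open>In terms of the entries (1,1), (1,2) and (2,1), the entries of the bracket are, up to
  non-zero factors, the two-by-two minors of \<open>x\<close> and \<open>y\<close>. Their vanishing
  gives proportionality, with the factor read off at a non-zero entry of \<open>y\<close>.\<close>

lemma proportional_if_lie_eq_zero:
  assumes "x \<in> sl2" "y \<in> sl2" "y \<noteq> 0" "lie x y = 0"
  shows "\<exists>k. x = mscale k y"
proof -
  define p q r a b c where "p = x $ 1 $ 1" "q = x $ 1 $ 2" "r = x $ 2 $ 1"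
    and "a = y $ 1 $ 1" "b = y $ 1 $ 2" "c = y $ 2 $ 1"
  note defs = this
  have x: "x $ 2 $ 2 = - p" and y: "y $ 2 $ 2 = - a"
    using assms(1,2) by (simp_all add: sl2_def trace_def sum_2 defs add_eq_0_iff)
  have "lie x y $ 1 $ 1 = 0" "lie x y $ 1 $ 2 = 0" "lie x y $ 2 $ 1 = 0"
    using assms(4) by simp_all
  then have *: "q * c = r * b" "p * b = q * a" "r * a = p * c"
    by (simp_all add: lie_def matrix_matrix_mult_def sum_2 x y flip: defs)
       (simp_all add: algebra_simps)
  have eq: "x = mscale k y" if "p = k * a" "q = k * b" "r = k * c" for k
    using that x y by (simp add: mscale_def vec_eq_iff forall_2 flip: defs)
  have "a \<noteq> 0 \<or> b \<noteq> 0 \<or> c \<noteq> 0"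
    using assms(3) y by (auto simp: vec_eq_iff forall_2 simp flip: defs)
  then show ?thesis
  proof (elim disjE)
    assume "a \<noteq> 0"
    then show ?thesis
      using * by (intro exI[of _ "p / a"] eq) (simp_all add: divide_simps mult.commute)
  next
    assume "b \<noteq> 0"
    then show ?thesis
      using * by (intro exI[of _ "q / b"] eq) (simp_all add: divide_simps mult.commute)
  next
    assume "c \<noteq> 0"
    then show ?thesis
      using * by (intro exI[of _ "r / c"] eq) (simp_all add: divide_simps mult.commute)
  qed
qed

text \<open>Necessity comes from applying \<open>brk\<close> to the bracket, sufficiency from
  \<open>quad_mem\<close>. In both directions antisymmetry of the Lie bracket turns the balance at
  \<open>H\<close> into twice the bracket of \<open>\<omega> H\<close> with the local sum.\<close>

lemma flat_conn_sl2_iff: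
  assumes "arrangement B"
  shows "\<omega> \<in> flat_conn B sl2 \<longleftrightarrow> (\<forall>H\<in>B. \<omega> H \<in> sl2) \<and> (\<forall>H. H \<notin> B \<longrightarrow> \<omega> H = 0) \<and>
    (\<forall>X\<in>L2 B. \<forall>H\<in>localization B X. lie (\<omega> H) (sum \<omega> (localization B X)) = 0)"
proof -
  let ?q = "quad B (\<lambda>H H'. lie (\<omega> H) (\<omega> H'))" and ?I = "ideal_tensor mscale (os_ideal_C B) sl2"
  have fin: "finite B"
    using assms by (simp add: arrangement_def)
  have loc: "localization B X \<subseteq> B" for X
    by (auto simp: localization_def)
  have bal: "(\<Sum>K\<in>L. lie (\<omega> H) (\<omega> K) - lie (\<omega> K) (\<omega> H)) = 2 *\<^sub>R lie (\<omega> H) (sum \<omega> L)" for H L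
  proof -
    have "(\<Sum>K\<in>L. lie (\<omega> H) (\<omega> K) - lie (\<omega> K) (\<omega> H)) = (\<Sum>K\<in>L. 2 *\<^sub>R lie (\<omega> H) (\<omega> K))"
      by (intro sum.cong refl) (simp add: lie_def scaleR_2)
    then show ?thesis
      by (simp add: lie_sum_right scaleR_right.sum)
  qed
  have "?q \<in> ?I \<longleftrightarrow> (\<forall>X\<in>L2 B. \<forall>H\<in>localization B X. lie (\<omega> H) (sum \<omega> (localization B X)) = 0)"
  proof
    assume "?q \<in> ?I"
    then have "os_null B ?q"
      by (rule os_null_os_ideal_mat[OF assms])
    then show "\<forall>X\<in>L2 B. \<forall>H\<in>localization B X. lie (\<omega> H) (sum \<omega> (localization B X)) = 0"
      by (simp add: os_null_def brk_quad[OF fin loc] bal)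
  next
    assume "\<forall>X\<in>L2 B. \<forall>H\<in>localization B X. lie (\<omega> H) (sum \<omega> (localization B X)) = 0"
    then show "?q \<in> ?I"
      by (intro quad_mem[OF assms os_submodule_os_ideal_mat] lie_mem_sl2) (simp add: bal)
  qed
  then show ?thesis
    by (simp add: flat_conn_def tens_lie_deg_one[OF fin])
qed

lemma arrangement_subset: "arrangement A \<Longrightarrow> B \<subseteq> A \<Longrightarrow> arrangement B"
  unfolding arrangement_def by (meson finite_subset subsetD)

lemma L2_mono: "B \<subseteq> A \<Longrightarrow> L2 B \<subseteq> L2 A"
  unfolding L2_def flats_def by blast

lemma sum_localization_subset:
  assumes "finite A" "B \<subseteq> A" "\<And>H. H \<in> A \<Longrightarrow> H \<notin> B \<Longrightarrow> f H = 0"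
  shows "sum f (localization A X) = sum f (localization B X)"
  using assms by (intro sum.mono_neutral_right) (auto simp: localization_def)

section \<open>Irreducible components of the resonance variety\<close>

lemma poly_funs_line:
  assumes "p \<in> poly_funs B"
  shows "\<exists>P. \<forall>t. p (\<lambda>H. a H + t * (b H - a H)) = poly P t"
  using assms
proof induction
  case (const c)
  show ?case
    by (rule exI[of _ "[:c:]"]) simp
next
  case (coord H)
  show ?case
    by (rule exI[of _ "[:a H, b H - a H:]"]) simp
next
  case (add p q)
  then show ?case
    by (metis poly_add)
next
  case (mult p q)
  then show ?case
    by (metis poly_mult)
qed

text \<open>If \<open>a\<close> is outside \<open>Y\<close> and \<open>b\<close> outside
  \<open>Z\<close>, take polynomials vanishing on \<open>Y\<close> and \<open>Z\<close> but not at
  \<open>a\<close> and \<open>b\<close>. Their product vanishes on the line through \<open>a\<close>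
  and \<open>b\<close>, so one factor restricts to the zero polynomial, against its value at
  parameter 0 or 1.\<close>

lemma zariski_irreducible_if_lines:
  assumes "V \<noteq> {}" "V \<subseteq> coord_space B"
    and line: "\<And>a b t. a \<in> V \<Longrightarrow> b \<in> V \<Longrightarrow> (\<lambda>H. a H + t * (b H - a H)) \<in> V"
  shows "zariski_irreducible B V"
  unfolding zariski_irreducible_def
proof (intro conjI allI impI assms(1,2))
  fix Y Z assume YZ: "zariski_closed B Y \<and> zariski_closed B Z \<and> V \<subseteq> Y \<union> Z"
  show "V \<subseteq> Y \<or> V \<subseteq> Z"
  proof (rule ccontr)
    assume "\<not> (V \<subseteq> Y \<or> V \<subseteq> Z)"
    then obtain a b where a: "a \<in> V" "a \<notin> Y" and b: "b \<in> V" "b \<notin> Z"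
      by auto
    obtain p where p: "p \<in> poly_funs B" "p a \<noteq> 0" "\<forall>v\<in>Y. p v = 0"
      using YZ a assms(2) unfolding zariski_closed_def by blast
    obtain q where q: "q \<in> poly_funs B" "q b \<noteq> 0" "\<forall>v\<in>Z. q v = 0"
      using YZ b assms(2) unfolding zariski_closed_def by blast
    obtain P where P: "\<And>t. p (\<lambda>H. a H + t * (b H - a H)) = poly P t"
      using poly_funs_line[OF p(1)] by blast
    obtain Q where Q: "\<And>t. q (\<lambda>H. a H + t * (b H - a H)) = poly Q t"
      using poly_funs_line[OF q(1)] by blast
    have "poly (P * Q) t = 0" for t
      using line[OF a(1) b(1), of t] YZ p(3) q(3) P[of t] Q[of t] by auto
    then have "P * Q = 0"
      using poly_all_0_iff_0 by blast
    then have "P = 0 \<or> Q = 0"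
      by simp
    then show False
      using P[of 0] Q[of 1] p(2) q(2) by auto
  qed
qed

text \<open>Zorn's lemma applies because the union of a chain of irreducible sets is irreducible: of
  a member not inside \<open>Y\<close> and a member not inside \<open>Z\<close>, the larger is
  inside neither.\<close>

lemma irreducible_component_exists:
  assumes "W \<subseteq> R" "zariski_irreducible B W"
  obtains V where "irreducible_component B R V" "W \<subseteq> V"
proof -
  define S where "S = {V. W \<subseteq> V \<and> V \<subseteq> R \<and> zariski_irreducible B V}"
  have "\<exists>M\<in>S. \<forall>V\<in>S. M \<subseteq> V \<longrightarrow> V = M"
  proof (rule subset_Zorn_nonempty)
    show "S \<noteq> {}"
      using assms by (auto simp: S_def)
    fix C assume C: "C \<noteq> {}" "subset.chain S C"
    have chain: "V \<subseteq> V' \<or> V' \<subseteq> V" if "V \<in> C" "V' \<in> C" for V V'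
      using C(2) that by (auto simp: subset.chain_def)
    have CS: "W \<subseteq> V" "V \<subseteq> R" "zariski_irreducible B V" if "V \<in> C" for V
      using C(2) that by (auto simp: subset.chain_def S_def)
    have "zariski_irreducible B (\<Union>C)"
      unfolding zariski_irreducible_def
    proof (intro conjI allI impI)
      show "\<Union>C \<noteq> {}" "\<Union>C \<subseteq> coord_space B"
        using C(1) CS(3) by (auto simp: zariski_irreducible_def)
      fix Y Z assume YZ: "zariski_closed B Y \<and> zariski_closed B Z \<and> \<Union>C \<subseteq> Y \<union> Z"
      show "\<Union>C \<subseteq> Y \<or> \<Union>C \<subseteq> Z"
      proof (rule ccontr)
        assume "\<not> (\<Union>C \<subseteq> Y \<or> \<Union>C \<subseteq> Z)"
        then obtain V V' where V: "V \<in> C" "V' \<in> C" "\<not> V \<subseteq> Y" "\<not> V' \<subseteq> Z"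
          by blast
        then obtain U where U: "U \<in> C" "\<not> U \<subseteq> Y" "\<not> U \<subseteq> Z"
          using chain[of V V'] by blast
        have "U \<subseteq> Y \<union> Z"
          using YZ U(1) by blast
        then show False
          using CS(3)[OF U(1)] YZ U(2,3) unfolding zariski_irreducible_def by blast
      qed
    qed
    then show "\<Union>C \<in> S"
      using C(1) CS by (auto simp: S_def)
  qed
  then obtain M where M: "M \<in> S" and max: "\<And>V. V \<in> S \<Longrightarrow> M \<subseteq> V \<Longrightarrow> V = M"
    by blast
  have M': "W \<subseteq> M" "M \<subseteq> R" "zariski_irreducible B M"
    using M by (simp_all add: S_def)
  have "V = M" if "M \<subseteq> V" "V \<subseteq> R" "zariski_irreducible B V" for V
    using max[OF _ that(1)] that M'(1) by (simp add: S_def)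
  then have "irreducible_component B R M"
    using M' by (simp add: irreducible_component_def)
  then show ?thesis
    using M'(1) that by blast
qed

text \<open>The form of \<open>b\<close> is the cohomology class sought: by \<open>bal\<close> its
  product with \<open>a\<close> is zero in the algebra. It is no coboundary, since coboundaries are
  scalar multiples of \<open>a\<close> and the ideal is zero in degree one.\<close>

lemma resonance_mem:
  assumes arr: "arrangement B" and a: "a \<in> coord_space B"
    and not_prop: "\<And>\<gamma>. \<exists>H\<in>B. b H \<noteq> \<gamma> * a H"
    and bal: "\<And>X H. X \<in> L2 B \<Longrightarrow> H \<in> localization B X \<Longrightarrow>
      a H * sum b (localization B X) = sum a (localization B X) * b H"
  shows "a \<in> resonance B"
proof -
  have fin: "finite B"
    using arr by (simp add: arrangement_def)
  have "deg_one B a * deg_one B b \<in> os_ideal_C B"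
    unfolding deg_one_mult
    by (rule quad_mem[OF arr os_submodule_os_ideal_C])
      (simp_all add: sum_subtractf bal flip: sum_distrib_left sum_distrib_right)
  moreover have False if c: "c \<in> tens_deg 0 B" "deg_one B b - deg_one B a * c \<in> os_ideal_C B" for c
  proof -
    define \<gamma> where "\<gamma> = Poly_Mapping.lookup c 0"
    have "c = Poly_Mapping.single 0 \<gamma>"
    proof (rule poly_mapping_eqI)
      fix w
      have "w = 0" if "w \<in> Poly_Mapping.keys c"
        using c(1) that by (cases w) (auto simp: tens_deg_def zero_word_def)
      then show "Poly_Mapping.lookup c w = Poly_Mapping.lookup (Poly_Mapping.single 0 \<gamma>) w"
        by (auto simp: \<gamma>_def lookup_single when_def in_keys_iff)
    qed
    then have ac: "deg_one B a * c = deg_one B (\<lambda>H. a H * \<gamma>)"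
      by (simp add: deg_one_def sum_distrib_right mult_single)
    obtain H where H: "H \<in> B" "b H \<noteq> \<gamma> * a H"
      using not_prop by blast
    have "Poly_Mapping.lookup (deg_one B b - deg_one B a * c) (Word [H]) = 0"
      using os_null_os_ideal_C[OF arr c(2)] by (simp add: os_null_def)
    then show False
      using H fin by (simp add: ac lookup_minus lookup_deg_one mult.commute)
  qed
  ultimately show ?thesis
    using a deg_one_mem_tens_deg[OF fin] unfolding resonance_def by blast
qed

section \<open>Nets and special cocycles\<close>

text \<open>On the class with index \<beta> the vector of class \<alpha> is the Kronecker delta.
  Summed over one representative of each class, every class vector gives 1, so the differences give
  0.\<close>

lemma net_component_sum:
  assumes "v \<in> net_component k cls" "0 < k"
    and disj: "\<And>\<alpha> \<beta>. \<alpha> < k \<Longrightarrow> \<beta> < k \<Longrightarrow> \<alpha> \<noteq> \<beta> \<Longrightarrow> cls \<alpha> \<inter> cls \<beta> = {}"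
  shows "\<alpha> < k \<Longrightarrow> H \<in> cls \<alpha> \<Longrightarrow> H' \<in> cls \<alpha> \<Longrightarrow> v H = v H'"
    and "(\<And>\<alpha>. \<alpha> < k \<Longrightarrow> h \<alpha> \<in> cls \<alpha>) \<Longrightarrow> (\<Sum>\<alpha><k. v (h \<alpha>)) = 0"
proof -
  obtain c where v: "v = (\<lambda>H. \<Sum>\<alpha>\<in>{1..<k}. c \<alpha> * (class_vec (cls \<alpha>) H - class_vec (cls 0) H))"
    using assms(1) by (auto simp: net_component_def)
  let ?d = "\<lambda>\<alpha> \<beta>. if \<alpha> = \<beta> then 1 else (0::complex)"
  have cv: "class_vec (cls \<alpha>) H = ?d \<alpha> \<beta>" if "\<alpha> < k" "\<beta> < k" "H \<in> cls \<beta>" for \<alpha> \<beta> H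
    using disj[OF that(1,2)] that by (auto simp: class_vec_def)
  have eq: "v H = (\<Sum>\<alpha>\<in>{1..<k}. c \<alpha> * (?d \<alpha> \<beta> - ?d 0 \<beta>))" if "\<beta> < k" "H \<in> cls \<beta>" for \<beta> H
    unfolding v using that assms(2) by (intro sum.cong refl) (simp add: cv)
  show "v H = v H'" if "\<alpha> < k" "H \<in> cls \<alpha>" "H' \<in> cls \<alpha>"
    using eq that by simp
  assume h: "\<And>\<alpha>. \<alpha> < k \<Longrightarrow> h \<alpha> \<in> cls \<alpha>"
  have "(\<Sum>\<beta><k. v (h \<beta>)) = (\<Sum>\<alpha>\<in>{1..<k}. \<Sum>\<beta><k. c \<alpha> * (?d \<alpha> \<beta> - ?d 0 \<beta>))"
    by (subst sum.swap) (intro sum.cong refl, use eq h in auto)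
  also have "\<dots> = (\<Sum>\<alpha>\<in>{1..<k}. c \<alpha> * ((\<Sum>\<beta><k. ?d \<alpha> \<beta>) - (\<Sum>\<beta><k. ?d 0 \<beta>)))"
    by (simp only: sum_distrib_left[symmetric] sum_subtractf)
  also have "\<dots> = 0"
    using assms(2) by (intro sum.neutral) auto
  finally show "(\<Sum>\<beta><k. v (h \<beta>)) = 0" .
qed

text \<open>If \<tau> takes two values at \<open>X\<close>, then \<open>X\<close> is an intersection
  across classes and so in the base locus. There each class has total multiplicity one, and as
  multiplicities are positive, exactly one hyperplane of each class passes through
  \<open>X\<close>.\<close>

lemma net_special_cocycle:
  fixes B :: "(complex^'l) set set"
  assumes arr: "arrangement B" and net: "net B k cls m \<X>"
    and \<tau>: "\<tau> \<in> extensional B" "\<And>H. H \<in> B \<Longrightarrow> \<tau> H < k \<and> H \<in> cls (\<tau> H)"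
  shows "\<tau> \<in> special_cocycles {..<k} B - const_cocycles {..<k} B"
proof -
  have mn: "multinet B k cls m \<X>"
    and one: "\<And>X \<alpha>. X \<in> \<X> \<Longrightarrow> \<alpha> < k \<Longrightarrow> (\<Sum>H\<in>cls \<alpha> \<inter> localization B X. m H) = 1"
    using net by (simp_all add: net_def)
  from mn have k: "k \<ge> 3" and ne: "\<forall>\<alpha><k. cls \<alpha> \<noteq> {}" and un: "(\<Union>\<alpha><k. cls \<alpha>) = B"
    and disj: "\<forall>\<alpha><k. \<forall>\<beta><k. \<alpha> \<noteq> \<beta> \<longrightarrow> cls \<alpha> \<inter> cls \<beta> = {}"
    and base: "\<forall>\<alpha><k. \<forall>\<beta><k. \<alpha> \<noteq> \<beta> \<longrightarrow> (\<forall>H\<in>cls \<alpha>. \<forall>H'\<in>cls \<beta>. H \<inter> H' \<in> \<X>)"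
    and m: "\<forall>H\<in>B. m H > 0"
    unfolding multinet_def by - ((elim conjE, assumption)+)
  have \<tau>_eq: "\<tau> H = \<alpha>" if "\<alpha> < k" "H \<in> cls \<alpha>" for H \<alpha>
    using disj \<tau>(2)[of H] un that by blast
  have \<tau>_fun: "\<tau> \<in> B \<rightarrow>\<^sub>E {..<k}"
    using \<tau> by (auto simp: PiE_def)
  have "\<tau> \<notin> const_cocycles {..<k} B"
  proof
    assume "\<tau> \<in> const_cocycles {..<k} B"
    then obtain \<kappa> where \<kappa>: "\<forall>H\<in>B. \<tau> H = \<kappa>"
      by (auto simp: const_cocycles_def)
    obtain H H' where "H \<in> cls 0" "H' \<in> cls 1"
      using ne k by (metis all_not_in_conv less_le_trans zero_less_numeral one_less_numeral_iff semiring_norm(77))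
    moreover from this have "H \<in> B" "H' \<in> B"
      using un k by fastforce+
    ultimately show False
      using \<tau>_eq[of 0 H] \<tau>_eq[of 1 H'] k \<kappa> by simp
  qed
  moreover have "(\<exists>\<kappa>\<in>{..<k}. \<forall>H\<in>localization B X. \<tau> H = \<kappa>) \<or> bij_betw \<tau> (localization B X) {..<k}"
    if X: "X \<in> L2 B" for X
  proof (cases "\<exists>H\<in>localization B X. \<exists>H'\<in>localization B X. \<tau> H \<noteq> \<tau> H'")
    case False
    then have "\<exists>\<kappa>\<in>{..<k}. \<forall>H\<in>localization B X. \<tau> H = \<kappa>"
    proof (cases "localization B X = {}")
      case True
      then show ?thesis
        using k by (intro bexI[of _ 0]) auto
    next
      case False
      then obtain H where H: "H \<in> localization B X"
        by auto
      then have "\<tau> H < k"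
        using \<tau>(2) by (auto simp: localization_def)
      then show ?thesis
        using H \<open>\<not> (\<exists>H\<in>localization B X. \<exists>H'\<in>localization B X. \<tau> H \<noteq> \<tau> H')\<close> by blast
    qed
    then show ?thesis ..
  next
    case True
    then obtain H H' where H: "H \<in> localization B X" "H' \<in> localization B X" "\<tau> H \<noteq> \<tau> H'"
      by auto
    have HB: "H \<in> B" "H' \<in> B"
      using H by (auto simp: localization_def)
    have "X = H \<inter> H'"
      using H by (intro L2_eq_inter[OF arr X]) auto
    then have "X \<in> \<X>"
      using base \<tau>(2)[OF HB(1)] \<tau>(2)[OF HB(2)] H(3) by blast
    note one = one[OF this]
    have fin: "finite (localization B X)" and LB: "localization B X \<subseteq> B"
      using arr by (auto simp: localization_def arrangement_def)
    have uniq: "\<exists>K. cls \<alpha> \<inter> localization B X = {K}" if \<alpha>: "\<alpha> < k" for \<alpha>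
    proof -
      let ?S = "cls \<alpha> \<inter> localization B X"
      have "finite ?S"
        using fin by simp
      then obtain K where K: "K \<in> ?S" "\<forall>K'\<in>?S. K \<noteq> K' \<longrightarrow> m K' = 0"
        using one[OF \<alpha>] sum_eq_1_iff[of ?S m] by blast
      moreover have "m K' \<noteq> 0" if "K' \<in> ?S" for K'
        using m that LB by fastforce
      ultimately show ?thesis
        by blast
    qed
    have "inj_on \<tau> (localization B X)"
    proof (rule inj_onI)
      fix H1 H2 assume H12: "H1 \<in> localization B X" "H2 \<in> localization B X" "\<tau> H1 = \<tau> H2"
      then have "H1 \<in> cls (\<tau> H1) \<inter> localization B X" "H2 \<in> cls (\<tau> H1) \<inter> localization B X" "\<tau> H1 < k"
        using \<tau>(2)[of H1] \<tau>(2)[of H2] LB by auto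
      then show "H1 = H2"
        using uniq[of "\<tau> H1"] by auto
    qed
    moreover have "\<tau> ` localization B X = {..<k}"
    proof
      show "\<tau> ` localization B X \<subseteq> {..<k}"
        using \<tau>(2) LB by auto
      show "{..<k} \<subseteq> \<tau> ` localization B X"
      proof
        fix \<alpha> assume "\<alpha> \<in> {..<k}"
        then have "\<alpha> < k"
          by simp
        then obtain K where "K \<in> cls \<alpha> \<inter> localization B X"
          using uniq by blast
        then show "\<alpha> \<in> \<tau> ` localization B X"
          using \<tau>_eq[OF \<open>\<alpha> < k\<close>, of K] by auto
      qed
    qed
    ultimately show ?thesis
      by (simp add: bij_betw_def)
  qed
  ultimately show ?thesis
    using \<tau>_fun by (simp add: special_cocycles_def)
qed

section \<open>Evaluations are regular flat connections\<close>

lemma dim_eq_if_zero_extension: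
  assumes "X \<subseteq> Y" "Y \<subseteq> insert 0 X"
  shows "mat.dim Y = mat.dim X"
proof -
  have "mat.span Y = mat.span X"
    using mat.span_mono[OF assms(1)] mat.span_mono[OF assms(2)] by (simp add: mat.span_insert_0)
  then show ?thesis
    by (metis mat.dim_span)
qed

text \<open>Two hyperplanes with different values meet in a flat on which \<tau> is not constant,
  hence bijective onto \<open>K\<close>.\<close>

lemma special_cocycle_surj:
  assumes arr: "arrangement B" and \<tau>: "\<tau> \<in> special_cocycles K B - const_cocycles K B" and "K \<noteq> {}"
  shows "\<tau> ` B = K"
proof -
  have fn: "\<tau> \<in> B \<rightarrow>\<^sub>E K" and sp: "\<And>X. X \<in> L2 B \<Longrightarrow> (\<exists>\<kappa>\<in>K. \<forall>H \<in> localization B X. \<tau> H = \<kappa>)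
      \<or> bij_betw \<tau> (localization B X) K"
    using \<tau> by (auto simp: special_cocycles_def)
  have "\<exists>H\<in>B. \<exists>H'\<in>B. \<tau> H \<noteq> \<tau> H'"
  proof (rule ccontr)
    assume *: "\<not> ?thesis"
    have "\<exists>\<kappa>\<in>K. \<forall>H\<in>B. \<tau> H = \<kappa>"
    proof (cases "B = {}")
      case True
      then show ?thesis
        using \<open>K \<noteq> {}\<close> by auto
    next
      case False
      then obtain H where "H \<in> B"
        by auto
      then show ?thesis
        using * PiE_mem[OF fn] by blast
    qed
    then show False
      using \<tau> fn by (auto simp: const_cocycles_def)
  qed
  then obtain H H' where H: "H \<in> B" "H' \<in> B" "\<tau> H \<noteq> \<tau> H'"
    by auto
  then have X: "H \<inter> H' \<in> L2 B"
    by (intro inter_mem_L2[OF arr]) auto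
  have "H \<in> localization B (H \<inter> H')" "H' \<in> localization B (H \<inter> H')"
    using H by (auto simp: localization_def)
  then have "\<tau> ` localization B (H \<inter> H') = K"
    using sp[OF X] H(3) by (auto simp: bij_betw_def)
  then show ?thesis
    using fn by (fastforce simp: localization_def)
qed

text \<open>Where \<tau> is constant through \<open>X\<close>, all values agree and commute; where
  it is bijective, the local sum is the sum of \<open>x\<close> over \<open>K\<close>, which is
  zero. Regularity is inherited because \<tau> is onto.\<close>

lemma ev_mem_flat_conn_reg:
  assumes arr: "arrangement A" and B: "B \<subseteq> A" and K: "K \<noteq> {}"
    and \<tau>: "\<tau> \<in> special_cocycles K B - const_cocycles K B" and x: "x \<in> eval_dom_reg K sl2"
  shows "ev B \<tau> x \<in> flat_conn_reg A sl2"
proof -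
  have arrB: "arrangement B"
    using arrangement_subset[OF arr B] .
  have finA: "finite A"
    using arr by (simp add: arrangement_def)
  have fn: "\<tau> \<in> B \<rightarrow>\<^sub>E K" and sp: "\<And>X. X \<in> L2 B \<Longrightarrow> (\<exists>\<kappa>\<in>K. \<forall>H \<in> localization B X. \<tau> H = \<kappa>)
      \<or> bij_betw \<tau> (localization B X) K"
    using \<tau> by (auto simp: special_cocycles_def)
  have xs: "x \<in> K \<rightarrow>\<^sub>E sl2" "(\<Sum>\<alpha>\<in>K. x \<alpha>) = 0" "mat.dim (mat.span (x ` K)) \<ge> 2"
    using x by (auto simp: eval_dom_reg_def eval_dom_def)
  have zero: "(0::complex^2^2) \<in> sl2"
    by (simp add: sl2_def trace_def)
  have "ev B \<tau> x \<in> flat_conn A sl2"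
    unfolding flat_conn_sl2_iff[OF arr]
  proof (intro conjI ballI allI impI)
    show "ev B \<tau> x H \<in> sl2" if "H \<in> A" for H
      using fn xs(1) zero by (auto simp: ev_def)
    show "ev B \<tau> x H = 0" if "H \<notin> A" for H
      using that B by (auto simp: ev_def)
    fix X H assume X: "X \<in> L2 A" "H \<in> localization A X"
    show "lie (ev B \<tau> x H) (sum (ev B \<tau> x) (localization A X)) = 0"
    proof (cases "H \<in> B")
      case False
      then show ?thesis
        by (simp add: ev_def)
    next
      case True
      let ?L = "localization B X"
      have H: "H \<in> ?L"
        using True X by (simp add: localization_def)
      have "sum (ev B \<tau> x) (localization A X) = sum (ev B \<tau> x) ?L"
        by (rule sum_localization_subset[OF finA B]) (simp add: ev_def)
      also have "\<dots> = (\<Sum>H'\<in>?L. x (\<tau> H'))"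
        by (intro sum.cong refl) (simp add: ev_def localization_def)
      finally have sum_eq: "sum (ev B \<tau> x) (localization A X) = (\<Sum>H'\<in>?L. x (\<tau> H'))" .
      \<comment> \<open>A flat of \<open>A\<close> with two hyperplanes of \<open>B\<close> through
        it is also a flat of \<open>B\<close>, so the cocycle condition applies; with only one,
        constancy is trivial.\<close>
      have "(\<forall>H'\<in>?L. \<tau> H' = \<tau> H) \<or> bij_betw \<tau> ?L K"
      proof (cases "?L = {H}")
        case False
        then obtain H' where H': "H' \<in> ?L" "H \<noteq> H'"
          using H by auto
        have "H \<in> localization A X" "H' \<in> localization A X"
          using H H' B by (auto simp: localization_def)
        then have "X = H \<inter> H'"
          using L2_eq_inter[OF arr X(1)] H' by blast
        then have "X \<in> L2 B"
          using inter_mem_L2[OF arrB, of H H'] H' True by (auto simp: localization_def)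
        then show ?thesis
          using sp[of X] H by auto
      qed simp
      then show ?thesis
      proof
        assume "\<forall>H'\<in>?L. \<tau> H' = \<tau> H"
        then show ?thesis
          unfolding sum_eq lie_sum_right using True by (simp add: ev_def)
      next
        assume "bij_betw \<tau> ?L K"
        then show ?thesis
          unfolding sum_eq using xs(2) by (simp add: sum.reindex_bij_betw)
      qed
    qed
  qed
  moreover have "mat.dim (ev B \<tau> x ` A) = mat.dim (x ` K)"
  proof (rule dim_eq_if_zero_extension)
    show "ev B \<tau> x ` A \<subseteq> insert 0 (x ` K)"
      using fn by (auto simp: ev_def)
    have "x ` K = ev B \<tau> x ` B"
      unfolding special_cocycle_surj[OF arrB \<tau> K, symmetric] by (auto simp: ev_def image_image)
    then show "x ` K \<subseteq> ev B \<tau> x ` A"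
      using B by auto
  qed
  ultimately show ?thesis
    using xs(3) by (simp add: flat_conn_reg_def)
qed

section \<open>The support of a regular flat connection\<close>

text \<open>Represents linear forms on matrices by matrices, so that forms can be added, scaled and
  quantified over as matrices.\<close>

definition pairing :: "complex^'n^'n \<Rightarrow> complex^'n^'n \<Rightarrow> complex" where
  "pairing f x = (\<Sum>i\<in>UNIV. \<Sum>j\<in>UNIV. f $ i $ j * x $ i $ j)"

lemma pairing_linear [simp]:
  "pairing f 0 = 0" "pairing f (x + y) = pairing f x + pairing f y"
  "pairing f (mscale k x) = k * pairing f x"
  by (simp_all add: pairing_def mscale_def algebra_simps sum.distrib sum_distrib_left)

lemma pairing_left_linear [simp]:
  "pairing (f + g) x = pairing f x + pairing g x" "pairing (f - g) x = pairing f x - pairing g x"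
  "pairing (mscale k f) x = k * pairing f x"
  by (simp_all add: pairing_def mscale_def algebra_simps sum.distrib sum_subtractf sum_distrib_left)

lemma pairing_sum: "pairing f (sum g S) = (\<Sum>i\<in>S. pairing f (g i))"
  by (induction S rule: infinite_finite_induct) simp_all

lemma pairing_axis [simp]: "pairing (axis i (axis j 1)) x = x $ i $ j"
proof -
  have "pairing (axis i (axis j 1)) x
      = (\<Sum>i'\<in>UNIV. if i' = i then (\<Sum>j'\<in>UNIV. if j' = j then x $ i' $ j' else 0) else 0)"
    unfolding pairing_def
    by (intro sum.cong refl) (simp add: axis_def if_distrib[of "\<lambda>x. x * _"] cong: if_cong)
  then show ?thesis
    by simp
qed

context
  fixes A :: "(complex^'l) set set" and \<omega> :: "(complex^'l) set \<Rightarrow> complex^2^2"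
  assumes arr: "arrangement A" and \<omega>: "\<omega> \<in> flat_conn_reg A sl2"
begin

text \<open>Restricting to the support ensures that no coordinate vanishes on all of
  \<open>comps\<close>, which gives essentiality.\<close>

definition supp :: "(complex^'l) set set" where
  "supp = {H \<in> A. \<omega> H \<noteq> 0}"

definition comps :: "((complex^'l) set \<Rightarrow> complex) set" where
  "comps = range (\<lambda>f H. pairing f (\<omega> H))"

lemma flat_facts:
  shows "H \<in> A \<Longrightarrow> \<omega> H \<in> sl2" "H \<notin> supp \<Longrightarrow> \<omega> H = 0"
    "X \<in> L2 A \<Longrightarrow> H \<in> localization A X \<Longrightarrow> lie (\<omega> H) (sum \<omega> (localization A X)) = 0"
proof -
  have "\<omega> \<in> flat_conn A sl2"
    using \<omega> by (simp add: flat_conn_reg_def)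
  then have *: "\<forall>H\<in>A. \<omega> H \<in> sl2" "\<forall>H. H \<notin> A \<longrightarrow> \<omega> H = 0"
    "\<forall>X\<in>L2 A. \<forall>H\<in>localization A X. lie (\<omega> H) (sum \<omega> (localization A X)) = 0"
    unfolding flat_conn_sl2_iff[OF arr] by - ((elim conjE, assumption)+)
  show "H \<in> A \<Longrightarrow> \<omega> H \<in> sl2"
    "X \<in> L2 A \<Longrightarrow> H \<in> localization A X \<Longrightarrow> lie (\<omega> H) (sum \<omega> (localization A X)) = 0"
    using * by blast+
  show "H \<notin> supp \<Longrightarrow> \<omega> H = 0"
    using *(2) by (auto simp: supp_def)
qed

lemma supp_subset: "supp \<subseteq> A"
  by (auto simp: supp_def)

lemma arrangement_supp: "arrangement supp"
  by (rule arrangement_subset[OF arr supp_subset])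

lemma comps_subset_coord_space: "comps \<subseteq> coord_space supp"
  by (auto simp: comps_def coord_space_def flat_facts(2))

text \<open>Flats of the support are flats of \<open>A\<close>, and hyperplanes off the support add
  nothing to the local sum. So flatness on \<open>A\<close> says that \<open>\<omega> H\<close>
  commutes with this sum, and commuting with a non-zero element of \<open>sl2\<close> means being a
  multiple of it.\<close>

lemma proportional_or_sum_zero:
  assumes X: "X \<in> L2 supp" and H: "H \<in> localization supp X"
  shows "sum \<omega> (localization supp X) = 0 \<or> (\<exists>k. \<omega> H = mscale k (sum \<omega> (localization supp X)))"
proof -
  have "finite A"
    using arr by (simp add: arrangement_def)
  then have "sum \<omega> (localization A X) = sum \<omega> (localization supp X)"
    by (rule sum_localization_subset) (use supp_subset flat_facts(2) in auto)
  moreover have "X \<in> L2 A" "H \<in> localization A X" "H \<in> A"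
    using X H L2_mono[OF supp_subset] supp_subset by (auto simp: localization_def)
  ultimately have "lie (\<omega> H) (sum \<omega> (localization supp X)) = 0" "\<omega> H \<in> sl2"
    using flat_facts by metis+
  moreover have "sum \<omega> (localization supp X) \<in> sl2"
  proof -
    have "trace (sum \<omega> S) = (\<Sum>K\<in>S. trace (\<omega> K))" for S
      by (induction S rule: infinite_finite_induct) (simp_all add: trace_add, simp_all add: trace_def)
    then show ?thesis
      using flat_facts(1) supp_subset by (auto simp: sl2_def localization_def intro!: sum.neutral)
  qed
  ultimately show ?thesis
    using proportional_if_lie_eq_zero by blast
qed

text \<open>Otherwise every matrix entry of \<omega> would be a multiple of \<open>a\<close>, all
  values of \<omega> would be multiples of one matrix, and \<omega> would not be regular.\<close>

lemma comps_not_proportional: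
  assumes "a \<in> comps"
  shows "\<exists>b\<in>comps. \<forall>\<gamma>. \<exists>H\<in>supp. b H \<noteq> \<gamma> * a H"
proof (rule ccontr)
  assume "\<not> ?thesis"
  then have "\<forall>b\<in>comps. \<exists>\<gamma>. \<forall>H\<in>supp. b H = \<gamma> * a H"
    by blast
  then have "\<forall>f. \<exists>\<gamma>. \<forall>H\<in>supp. pairing f (\<omega> H) = \<gamma> * a H"
    by (auto simp: comps_def)
  then obtain \<gamma> where \<gamma>: "\<And>f H. H \<in> supp \<Longrightarrow> pairing f (\<omega> H) = \<gamma> f * a H"
    by metis
  \<comment> \<open>The entries of \<open>y\<close> are the proportionality factors of the
    coordinate forms.\<close>
  define y where "y = (\<chi> i j. \<gamma> (axis i (axis j 1)))"
  have "\<omega> H = mscale (a H) y" if "H \<in> supp" for H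
    using \<gamma>[OF that, of "axis _ (axis _ 1)"] by (simp add: vec_eq_iff mscale_def y_def mult.commute)
  then have "\<omega> H \<in> mat.span {y}" for H
    using flat_facts(2)[of H] mat.span_zero by (cases "H \<in> supp") (auto simp: mat.span_singleton)
  then have "mat.dim (\<omega> ` A) \<le> card {y}"
    by (intro mat.dim_le_card) auto
  then show False
    using \<omega> by (simp add: flat_conn_reg_def)
qed

lemma comps_subset_resonance: "comps \<subseteq> resonance supp"
proof
  fix a assume a: "a \<in> comps"
  then obtain b where b: "b \<in> comps" "\<And>\<gamma>. \<exists>H\<in>supp. b H \<noteq> \<gamma> * a H"
    using comps_not_proportional by blast
  obtain f g where a_eq: "a = (\<lambda>H. pairing f (\<omega> H))" and b_eq: "b = (\<lambda>H. pairing g (\<omega> H))"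
    using a b(1) by (auto simp: comps_def)
  show "a \<in> resonance supp"
  proof (rule resonance_mem[OF arrangement_supp _ b(2)])
    show "a \<in> coord_space supp"
      using a comps_subset_coord_space by blast
    fix X H assume XH: "X \<in> L2 supp" "H \<in> localization supp X"
    let ?S = "sum \<omega> (localization supp X)"
    have "sum a (localization supp X) = pairing f ?S" "sum b (localization supp X) = pairing g ?S"
      by (simp_all add: a_eq b_eq pairing_sum)
    then show "a H * sum b (localization supp X) = sum a (localization supp X) * b H"
      \<comment> \<open>Either both sums vanish, or with \<open>\<omega> H = mscale k ?S\<close>
        both sides equal \<open>k * pairing f ?S * pairing g ?S\<close>.\<close>
      using proportional_or_sum_zero[OF XH] by (auto simp: a_eq b_eq)
  qed
qed

lemma comps_irreducible: "zariski_irreducible supp comps"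
proof (rule zariski_irreducible_if_lines[OF _ comps_subset_coord_space])
  show "comps \<noteq> {}"
    unfolding comps_def by blast
  fix a b t assume "a \<in> comps" "b \<in> comps"
  then obtain f g where "a = (\<lambda>H. pairing f (\<omega> H))" "b = (\<lambda>H. pairing g (\<omega> H))"
    by (auto simp: comps_def)
  then have "(\<lambda>H. a H + t * (b H - a H)) = (\<lambda>H. pairing (f + mscale t (g - f)) (\<omega> H))"
    by simp
  then show "(\<lambda>H. a H + t * (b H - a H)) \<in> comps"
    unfolding comps_def by (rule range_eqI)
qed

section \<open>Recovering the connection from a net on its support\<close>

lemma entry_mem_comps: "(\<lambda>H. \<omega> H $ i $ j) \<in> comps"
  unfolding comps_def by (rule range_eqI[of _ _ "axis i (axis j 1)"]) simp

lemma flat_conn_reg_eq_ev: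
  assumes nets: "\<And>V. irreducible_component supp (resonance supp) V \<Longrightarrow> essential supp V \<Longrightarrow>
      arises_from_net supp V"
  obtains k :: nat and \<tau> x where "k \<ge> 3" "\<tau> \<in> special_cocycles {..<k} supp - const_cocycles {..<k} supp"
    "x \<in> eval_dom_reg {..<k} sl2" "\<omega> = ev supp \<tau> x"
proof -
  obtain V where V: "irreducible_component supp (resonance supp) V" "comps \<subseteq> V"
    using irreducible_component_exists[OF comps_subset_resonance comps_irreducible] .
  have "essential supp V"
    unfolding essential_def
  proof (intro ballI notI)
    fix H assume H: "H \<in> supp" "V \<subseteq> {a. a H = 0}"
    \<comment> \<open>The component contains every matrix entry of \<omega>, so a vanishing
      coordinate at \<open>H\<close> would force \<open>\<omega> H = 0\<close>.\<close>
    have "\<omega> H $ i $ j = 0" for i j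
      using entry_mem_comps[of i j] V(2) H(2) by blast
    then show False
      using H(1) by (simp add: supp_def vec_eq_iff)
  qed
  then obtain k cls m \<X> where net: "net supp k cls m \<X>" and V_eq: "V = net_component k cls"
    using nets[OF V(1)] by (auto simp: arises_from_net_def)
  have mn: "multinet supp k cls m \<X>"
    using net by (simp add: net_def)
  then have k: "k \<ge> 3" and ne: "\<forall>\<alpha><k. cls \<alpha> \<noteq> {}" and un: "(\<Union>\<alpha><k. cls \<alpha>) = supp"
    and disj: "\<forall>\<alpha><k. \<forall>\<beta><k. \<alpha> \<noteq> \<beta> \<longrightarrow> cls \<alpha> \<inter> cls \<beta> = {}"
    unfolding multinet_def by - ((elim conjE, assumption)+)
  have entry: "(\<lambda>H. \<omega> H $ i $ j) \<in> net_component k cls" for i j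
    using entry_mem_comps V(2) V_eq by blast
  have disj': "\<alpha> < k \<Longrightarrow> \<beta> < k \<Longrightarrow> \<alpha> \<noteq> \<beta> \<Longrightarrow> cls \<alpha> \<inter> cls \<beta> = {}" for \<alpha> \<beta>
    using disj by simp
  have k0: "0 < k"
    using k by simp
  have cls_const: "\<omega> H = \<omega> H'" if "\<alpha> < k" "H \<in> cls \<alpha>" "H' \<in> cls \<alpha>" for \<alpha> H H'
    using net_component_sum(1)[OF entry k0 disj' that] by (simp add: vec_eq_iff)
  \<comment> \<open>A representative of each class; the value of \<omega> there, common to the
    class, becomes the coordinate of \<open>x\<close>.\<close>
  define h where "h = (\<lambda>\<alpha>. SOME H. H \<in> cls \<alpha>)"
  have h: "h \<alpha> \<in> cls \<alpha>" if "\<alpha> < k" for \<alpha>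
    using ne that by (simp add: h_def some_in_eq)
  have h_sum: "(\<Sum>\<alpha><k. \<omega> (h \<alpha>)) = 0"
    using net_component_sum(2)[OF entry k0 disj' h] by (simp add: vec_eq_iff)
  have "\<forall>H\<in>supp. \<exists>\<alpha><k. H \<in> cls \<alpha>"
    using un by blast
  then obtain \<tau>0 where \<tau>0: "\<And>H. H \<in> supp \<Longrightarrow> \<tau>0 H < k \<and> H \<in> cls (\<tau>0 H)"
    by metis
  define \<tau> where "\<tau> = restrict \<tau>0 supp"
  have \<tau>: "\<tau> \<in> extensional supp" "\<And>H. H \<in> supp \<Longrightarrow> \<tau> H < k \<and> H \<in> cls (\<tau> H)"
    using \<tau>0 by (simp_all add: \<tau>_def)
  define x where "x = restrict (\<lambda>\<alpha>. \<omega> (h \<alpha>)) {..<k}"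
  have hA: "h \<alpha> \<in> A" if "\<alpha> < k" for \<alpha>
    using h[OF that] that un supp_subset by blast
  have x_eq: "\<omega> H = x (\<tau> H)" if "H \<in> supp" for H
    using cls_const[of "\<tau> H" H "h (\<tau> H)"] \<tau>(2)[OF that] h by (simp add: x_def)
  \<comment> \<open>The values of \<open>x\<close> are those of \<omega> up to zero, so regularity
    passes to \<open>x\<close>.\<close>
  have "mat.dim (\<omega> ` A) = mat.dim (x ` {..<k})"
  proof (rule dim_eq_if_zero_extension)
    show "x ` {..<k} \<subseteq> \<omega> ` A"
      using hA by (auto simp: x_def)
    show "\<omega> ` A \<subseteq> insert 0 (x ` {..<k})"
    proof
      fix y assume "y \<in> \<omega> ` A"
      then obtain H where "y = \<omega> H"
        by blast
      then show "y \<in> insert 0 (x ` {..<k})"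
        using flat_facts(2)[of H] x_eq[of H] \<tau>(2)[of H] by (cases "H \<in> supp") auto
    qed
  qed
  then have "x \<in> eval_dom_reg {..<k} sl2"
    using \<omega> h_sum flat_facts(1) hA
    by (auto simp: eval_dom_reg_def eval_dom_def flat_conn_reg_def x_def)
  moreover have "\<omega> = ev supp \<tau> x"
    using x_eq flat_facts(2) by (auto simp: ev_def)
  ultimately show ?thesis
    using that[OF k net_special_cocycle[OF arrangement_supp net \<tau>]] by blast
qed

end

theorem theorem1p8:
  fixes A :: "(complex^'l) set set"
  assumes "arrangement A"
    and "\<And>B V. B \<subseteq> A \<Longrightarrow> irreducible_component B (resonance B) V \<Longrightarrow> essential B V
           \<Longrightarrow> arises_from_net B V"
  shows "flat_conn_reg A sl2 =
    (\<Union>{ev B \<tau> ` eval_dom_reg K sl2 | B (K :: nat set) \<tau>.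
         B \<subseteq> A \<and> finite K \<and> card K \<ge> 3 \<and> \<tau> \<in> special_cocycles K B - const_cocycles K B})"
    (is "_ = \<Union>?E")
proof (intro subset_antisym subsetI)
  fix \<omega> assume \<omega>: "\<omega> \<in> flat_conn_reg A sl2"
  let ?B = "supp A \<omega>"
  have B: "?B \<subseteq> A"
    by (rule supp_subset[OF assms(1) \<omega>])
  obtain k :: nat and \<tau> x where k: "k \<ge> 3"
    and \<tau>: "\<tau> \<in> special_cocycles {..<k} ?B - const_cocycles {..<k} ?B"
    and x: "x \<in> eval_dom_reg {..<k} sl2" and eq: "\<omega> = ev ?B \<tau> x"
    using flat_conn_reg_eq_ev[OF assms(1) \<omega> assms(2)[OF B]] by blast
  have "ev ?B \<tau> ` eval_dom_reg {..<k} sl2 \<in> ?E"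
    \<comment> \<open>Nets index their classes by an initial segment of the naturals, which serves
      as \<open>K\<close>.\<close>
    using B k \<tau> by (intro CollectI exI[of _ ?B] exI[of _ "{..<k}"] exI[of _ \<tau>]) simp
  then show "\<omega> \<in> \<Union>?E"
    using x eq by blast
next
  fix \<omega> assume "\<omega> \<in> \<Union>?E"
  then obtain B \<tau> x and K :: "nat set" where *: "\<omega> = ev B \<tau> x" "x \<in> eval_dom_reg K sl2" "B \<subseteq> A" "card K \<ge> 3"
    "\<tau> \<in> special_cocycles K B - const_cocycles K B"
    by blast
  \<comment> \<open>An infinite or empty set has \<open>card\<close> 0, so the bound on
    \<open>card K\<close> excludes the empty set, as surjectivity of the cocycle requires.\<close>
  then have "K \<noteq> {}"
    by auto
  then show "\<omega> \<in> flat_conn_reg A sl2"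
    using ev_mem_flat_conn_reg[OF assms(1) *(3) _ *(5) *(2)] *(1) by simp
qed

end
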